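(* A representation of the kernel $\mathcal K$ of the resolvent of $A$ in the form $$\mathcal K(x,x',\lambda)=\begin{cases}\displaystyle\sum_{q=1}^p\Bigl(\sum_{l=1}^p\alpha_{lq}\,w_l(x,\lambda)\Bigr)w_q(x',\lambda)^T,& x'\le x,\\[2mm]\displaystyle\sum_{q=1}^p\Bigl(\sum_{l=1}^p\beta_{lq}\,w_l(x,\lambda)\Bigr)w_q(x',\lambda)^T,& x'>x,\end{cases}$$ for $x,x'\in(0,+\infty)$ and $\lambda\in\rho(A)$, is not possible using exclusively generalized eigenfunctions satisfying the transmission conditions; that is, there are no $p\in\mathbb N$, $\alpha_{lq},\beta_{lq}\in\mathbb C$ ($l,q=1,\dots,p$) and functions $w_q:[0,\infty)\times\mathbb C\to\mathbb C^n$ with $$w_q(\cdot,\lambda)\in\ker(A_T-\lambda I),\qquad q=1,\dots,p,\ \lambda\in\rho(A),$$ for which this representation holds.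
   Context: Let $n\ge 2$, $c_1,\dots,c_n>0$ and $0\le a_1\le a_2\le\dots\le a_n<+\infty$. Let $N_1,\dots,N_n$ be $n$ disjoint copies of $(0,+\infty)$ and let $N=\bigcup_{k=1}^n\overline{N_k}$ with the endpoints $0$ of all branches identified (star-shaped network). Functions on $N$ are identified with $n$-tuples of functions on the branches, and thus with $\mathbb C^n$-valued functions on $[0,\infty)$. Transmission conditions for $(u_k)_{k=1}^n$: $(T_0)$: $u_k\in C^0([0,\infty))$ and $u_i(0)=u_k(0)$ for all $i,k$; $(T_1)$: $u_k\in C^1([0,\infty))$ and $\sum_{k=1}^n c_k u_k'(0^+)=0$. $H=\prod_{k=1}^n L^2(N_k)$ (complex-valued functions). The operator $A:D(A)\to H$ is $A(u_k)_k=(-c_k u_k''+a_k u_k)_k$ with $D(A)=\{(u_k)\in\prod_k H^2(N_k): (T_0)\text{ and }(T_1)\text{ hold}\}$ (it is self-adjoint). $A_T$ is given by the same differential expression $(-c_k\partial_x^2+a_k)_k$ on the domain of all $(u_k)_k\in\prod_kC^2(\overline{N_k})$ satisfying $(T_0)$ and $(T_1)$ (no integrability at infinity); $\ker(A_T-\lambda I)$ is the $n$-dimensional space of generalized eigenfunctions satisfying the transmission conditions. The complex square root is $\sqrt{re^{i\phi}}=\sqrt r\,e^{i\phi/2}$ for $r>0$, $\phi\in[-\pi,\pi)$. For $\lambda\in\mathbb C$: $\xi_k(\lambda)=\sqrt{(\lambda-a_k)/c_k}$, $s_k(\lambda)=-\dfrac{\sum_{l\ne k}c_l\xi_l(\lambda)}{c_k\xi_k(\lambda)}$.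 The functions $F_\lambda^{\pm,j}:N\to\mathbb C$ are given on $\overline{N_k}$ by $F_{\lambda,k}^{\pm,j}$, where $F_{\lambda,j}^{\pm,j}(x)=\cos(\xi_j(\lambda)x)\pm i\,s_j(\lambda)\sin(\xi_j(\lambda)x)$ and $F_{\lambda,k}^{\pm,j}(x)=\exp(\pm i\xi_k(\lambda)x)$ for $k\ne j$. Let $w(\lambda)=\pm i\sum_{j=1}^n c_j\xi_j(\lambda)$ (a scalar, not to be confused with the $w_q$). For $w(\lambda)\ne0$ and $x\in\overline{N_j}$ the kernel of the resolvent $(\lambda I-A)^{-1}$ is $$K(x,x',\lambda)=\begin{cases}\frac1{w(\lambda)}F_{\lambda,j}^{\pm,j}(x)\,F_{\lambda,j}^{\pm,j+1}(x'),& x'\in\overline{N_j},\ x'>x,\\ \frac1{w(\lambda)}F_{\lambda,j}^{\pm,j+1}(x)\,F_{\lambda}^{\pm,j}(x'),& x'\in\overline{N_k},\,k\ne j,\ \text{or } x'\in\overline{N_j},\ x'<x\end{cases}$$ (both expressions agree for $x=x'\in\overline{N_j}$); the sign $+$ is chosen throughout if $\operatorname{Im}\lambda>0$ and $-$ if $\operatorname{Im}\lambda\le0$; $j+1$ is modulo $n$. The matrix-valued kernel $\mathcal K(\cdot,\cdot,\lambda):(0,\infty)\times(0,\infty)\to\mathbb C^{n\times n}$ is defined by $\mathcal K_{ij}(x,x',\lambda)=K(x,x',\lambda)$ with $x$ regarded as a point of $N_i$ and $x'$ as a point of $N_j$. *)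

theory Defs
  imports "HOL-Analysis.Analysis"
begin

text \<open>
  The branches are indexed by \<open>k < n\<close> (so branch \<open>k\<close> here is the branch \<open>N\<^sub>k\<^sub>+\<^sub>1\<close> of a
  numbering from 1). A function on the network is a tuple \<open>u :: nat \<Rightarrow> real \<Rightarrow> complex\<close>, where
  \<open>u k x\<close> is its value at the point \<open>x \<ge> 0\<close> of branch \<open>k\<close>; values for \<open>k \<ge> n\<close> or \<open>x < 0\<close>
  are irrelevant. Elements of \<open>L\<^sup>2\<close> are given by representatives, and equality in \<open>H\<close> is
  equality almost everywhere.
\<close>

type_synonym net_fun = "nat \<Rightarrow> real \<Rightarrow> complex"


subsection \<open>Function spaces on the half-line\<close>

definition L2 :: "(real \<Rightarrow> complex) set" where
  "L2 = {u. set_borel_measurable lborel {0<..} u \<and>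
            set_integrable lborel {0<..} (\<lambda>x. (cmod (u x))\<^sup>2)}"

text \<open>\<open>C\<^sub>c\<^sup>\<infinity>(0,\<infinity>)\<close>, extended by zero. Real-valued test functions suffice, since the identity
  defining weak derivatives is linear in the test function.\<close>

definition test_functions :: "(real \<Rightarrow> real) set" where
  "test_functions = {\<phi>. (\<forall>m x. (deriv ^^ m) \<phi> differentiable at x) \<and>
                        compact (closure {x. \<phi> x \<noteq> 0}) \<and> closure {x. \<phi> x \<noteq> 0} \<subseteq> {0<..}}"

definition has_weak_deriv :: "(real \<Rightarrow> complex) \<Rightarrow> (real \<Rightarrow> complex) \<Rightarrow> bool" where
  "has_weak_deriv u v \<longleftrightarrow>
     (\<forall>\<phi>\<in>test_functions.
        (LINT x:{0<..}|lborel. deriv \<phi> x *\<^sub>R u x) = - (LINT x:{0<..}|lborel. \<phi> x *\<^sub>R v x))"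

definition H2 :: "(real \<Rightarrow> complex) set" where
  "H2 = {u \<in> L2. \<exists>v\<in>L2. has_weak_deriv u v \<and> (\<exists>w\<in>L2. has_weak_deriv v w)}"

text \<open>A representative of the weak derivative, which is unique up to null sets.\<close>

definition weak_deriv :: "(real \<Rightarrow> complex) \<Rightarrow> (real \<Rightarrow> complex)" where
  "weak_deriv u = (SOME v. v \<in> L2 \<and> has_weak_deriv u v)"

text \<open>The classical derivative on \<open>[0,\<infinity>)\<close>, one-sided at \<open>0\<close>.\<close>

definition D_half :: "(real \<Rightarrow> complex) \<Rightarrow> (real \<Rightarrow> complex)" where
  "D_half u = (\<lambda>x. vector_derivative u (at x within {0..}))"

fun C_halfline :: "nat \<Rightarrow> (real \<Rightarrow> complex) set" where
  "C_halfline 0 = {u. continuous_on {0..} u}"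
| "C_halfline (Suc m) = {u. u differentiable_on {0..} \<and> D_half u \<in> C_halfline m}"


subsection \<open>The Hilbert space and resolvent sets\<close>

definition H_space :: "nat \<Rightarrow> net_fun set" where
  "H_space n = {u. \<forall>k<n. u k \<in> L2}"

definition eq_H :: "nat \<Rightarrow> net_fun \<Rightarrow> net_fun \<Rightarrow> bool" where
  "eq_H n u v \<longleftrightarrow> (\<forall>k<n. AE x in lborel. x > 0 \<longrightarrow> u k x = v k x)"

definition norm_H :: "nat \<Rightarrow> net_fun \<Rightarrow> real" where
  "norm_H n u = sqrt (\<Sum>k<n. LINT x:{0<..}|lborel. (cmod (u k x))\<^sup>2)"

text \<open>\<open>\<rho>(T)\<close> for \<open>T : U \<rightarrow> H\<close>: the numbers \<open>z\<close> for which \<open>z I - T : U \<rightarrow> H\<close> is bijective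
  with bounded inverse.\<close>

definition resolvent_set :: "nat \<Rightarrow> net_fun set \<Rightarrow> (net_fun \<Rightarrow> net_fun) \<Rightarrow> complex set" where
  "resolvent_set n U T = {z.
     let R = (\<lambda>u k x. z * u k x - T u k x) in
       (\<forall>f\<in>H_space n. \<exists>u\<in>U. eq_H n (R u) f) \<and>
       (\<forall>u\<in>U. \<forall>v\<in>U. eq_H n (R u) (R v) \<longrightarrow> eq_H n u v) \<and>
       (\<exists>M. \<forall>u\<in>U. norm_H n u \<le> M * norm_H n (R u))}"


subsection \<open>Transmission conditions and the operators\<close>

definition T0 :: "nat \<Rightarrow> net_fun \<Rightarrow> bool" where
  "T0 n u \<longleftrightarrow> (\<forall>k<n. u k \<in> C_halfline 0) \<and> (\<forall>i<n. \<forall>k<n. u i 0 = u k 0)"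

definition T1 :: "nat \<Rightarrow> (nat \<Rightarrow> real) \<Rightarrow> net_fun \<Rightarrow> bool" where
  "T1 n c u \<longleftrightarrow> (\<forall>k<n. u k \<in> C_halfline 1) \<and> (\<Sum>k<n. complex_of_real (c k) * D_half (u k) 0) = 0"

text \<open>Since \<open>T0\<close> and \<open>T1\<close> are imposed on the representative itself, \<open>dom_A\<close> contains of each
  class in the domain of \<open>A\<close> exactly the continuously differentiable representatives.\<close>

definition dom_A :: "nat \<Rightarrow> (nat \<Rightarrow> real) \<Rightarrow> net_fun set" where
  "dom_A n c = {u. (\<forall>k<n. u k \<in> H2) \<and> T0 n u \<and> T1 n c u}"

definition op_A :: "(nat \<Rightarrow> real) \<Rightarrow> (nat \<Rightarrow> real) \<Rightarrow> net_fun \<Rightarrow> net_fun" where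
  "op_A c a u = (\<lambda>k x. - complex_of_real (c k) * weak_deriv (weak_deriv (u k)) x
                       + complex_of_real (a k) * u k x)"

definition rho_A :: "nat \<Rightarrow> (nat \<Rightarrow> real) \<Rightarrow> (nat \<Rightarrow> real) \<Rightarrow> complex set" where
  "rho_A n c a = resolvent_set n (dom_A n c) (op_A c a)"

definition dom_A_T :: "nat \<Rightarrow> (nat \<Rightarrow> real) \<Rightarrow> net_fun set" where
  "dom_A_T n c = {u. (\<forall>k<n. u k \<in> C_halfline 2) \<and> T0 n u \<and> T1 n c u}"

definition op_A_T :: "(nat \<Rightarrow> real) \<Rightarrow> (nat \<Rightarrow> real) \<Rightarrow> net_fun \<Rightarrow> net_fun" where
  "op_A_T c a u = (\<lambda>k x. - complex_of_real (c k) * D_half (D_half (u k)) x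
                       + complex_of_real (a k) * u k x)"

definition ker_A_T :: "nat \<Rightarrow> (nat \<Rightarrow> real) \<Rightarrow> (nat \<Rightarrow> real) \<Rightarrow> complex \<Rightarrow> net_fun set" where
  "ker_A_T n c a z = {u \<in> dom_A_T n c. \<forall>k<n. \<forall>x\<ge>0. op_A_T c a u k x - z * u k x = 0}"


subsection \<open>The resolvent kernel\<close>

text \<open>The square root with argument taken in \<open>[-\<pi>,\<pi>)\<close>; it differs from \<^const>\<open>csqrt\<close> on the
  negative real axis, where \<^const>\<open>Arg\<close> is \<open>\<pi>\<close>.\<close>

definition branch_sqrt :: "complex \<Rightarrow> complex" where
  "branch_sqrt z = complex_of_real (sqrt (cmod z)) * cis ((if Arg z = pi then - pi else Arg z) / 2)"

definition xi :: "(nat \<Rightarrow> real) \<Rightarrow> (nat \<Rightarrow> real) \<Rightarrow> complex \<Rightarrow> nat \<Rightarrow> complex" where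
  "xi c a z k = branch_sqrt ((z - complex_of_real (a k)) / complex_of_real (c k))"

definition s_coef :: "nat \<Rightarrow> (nat \<Rightarrow> real) \<Rightarrow> (nat \<Rightarrow> real) \<Rightarrow> complex \<Rightarrow> nat \<Rightarrow> complex" where
  "s_coef n c a z k = - (\<Sum>l\<in>{..<n} - {k}. complex_of_real (c l) * xi c a z l)
                   / (complex_of_real (c k) * xi c a z k)"

text \<open>The sign denoted \<open>\<plusminus>\<close>, which depends on the spectral parameter.\<close>

definition sg :: "complex \<Rightarrow> complex" where
  "sg z = (if Im z > 0 then 1 else - 1)"

text \<open>\<open>F_gen n c a z j k\<close> is the component on branch \<open>k\<close> of the function with upper index \<open>\<plusminus>,j\<close>.\<close>

definition F_gen :: "nat \<Rightarrow> (nat \<Rightarrow> real) \<Rightarrow> (nat \<Rightarrow> real) \<Rightarrow> complex \<Rightarrow> nat \<Rightarrow> nat \<Rightarrow> real \<Rightarrow> complex" where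
  "F_gen n c a z j k x =
     (if k = j
      then cos (xi c a z j * complex_of_real x)
             + sg z * \<i> * s_coef n c a z j * sin (xi c a z j * complex_of_real x)
      else exp (sg z * \<i> * xi c a z k * complex_of_real x))"

definition w_scalar :: "nat \<Rightarrow> (nat \<Rightarrow> real) \<Rightarrow> (nat \<Rightarrow> real) \<Rightarrow> complex \<Rightarrow> complex" where
  "w_scalar n c a z = sg z * \<i> * (\<Sum>j<n. complex_of_real (c j) * xi c a z j)"

text \<open>\<open>res_kernel n c a i j x y z\<close> is the entry \<open>(i,j)\<close> of the matrix-valued kernel at \<open>(x,y,z)\<close>, that
  is, the scalar kernel for \<open>x\<close> on branch \<open>i\<close> and \<open>y\<close> on branch \<open>j\<close>. It is
  meaningful where \<open>w_scalar n c a z \<noteq> 0\<close>, in particular on the resolvent set of \<open>A\<close>.\<close>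

definition res_kernel ::
  "nat \<Rightarrow> (nat \<Rightarrow> real) \<Rightarrow> (nat \<Rightarrow> real) \<Rightarrow> nat \<Rightarrow> nat \<Rightarrow> real \<Rightarrow> real \<Rightarrow> complex \<Rightarrow> complex" where
  "res_kernel n c a i j x y z =
     (let i' = (i + 1) mod n in
      if j = i \<and> x < y
      then 1 / w_scalar n c a z * F_gen n c a z i i x * F_gen n c a z i' i y
      else 1 / w_scalar n c a z * F_gen n c a z i' i x * F_gen n c a z i j y)"

end

(*
  At the point -1 of the resolvent set all exponents are real: with kappa_k = sqrt ((1 + a_k) / c_k),
  the generalized eigenfunctions are combinations of exp (kappa_k x) and exp (- kappa_k x) on the
  k-th branch. Fix x = 1 on branch 0. For y > 1 the kernel, as a function of y, equals
  C_j exp (- kappa_j y) on the branches j = 0 and j = 1. If the kernel were represented by generalized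
  eigenfunctions, so would be this function of y, and its unique extension to y = 0 would be
  continuous at the vertex, that is, C_0 = C_1. But C_0 and C_1 are proportional, with the same
  factor, to cosh kappa_0 + sigma sinh kappa_0 with sigma >= 0 and to exp (- kappa_0).

  That -1 is in the resolvent set follows from an energy estimate (integration by parts against the
  conjugate; the boundary terms cancel by the transmission conditions), which gives injectivity and
  boundedness, and from solving u'' = kappa^2 u + g on each branch by the factors p' = kappa p + g
  and v' = - kappa v + p, the free constants v(0) being fixed by the transmission conditions.
*)

theory Submission
  imports Defs
begin

subsection \<open>Smooth bump functions\<close>

text \<open>The cut between the two cases of the representation lies at the same coordinate on all
  branches, whereas the source of the kernel is a single point of branch 0. The tails of the kernel
  beyond the cut therefore belong to different solutions: on branch 0 the tail starts at the source,
  on the other branches it has come through the vertex. Continued back to the vertex they need not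
  meet, while sums of generalized eigenfunctions must.

  Most of the effort goes into the point of the resolvent set. \<open>H2\<close> is defined through
  test functions, and \<open>op_A\<close> uses an arbitrarily chosen representative of the weak
  second derivative, so integration by parts first needs a bridge to classical calculus: for a
  continuously differentiable function in \<open>H2\<close>, the derivative is an indefinite
  integral of the weak second derivative. This bridge is the lemma of du Bois-Reymond, and its proof
  needs explicit test functions; hence the bumps. Keeping the density as an explicit argument
  (\<open>abs_cont\<close>) reduces every rule of calculus to a statement about integrals.\<close>

definition flat :: "nat \<Rightarrow> real \<Rightarrow> real" where
  "flat k x = (if x > 0 then (1 / x) ^ k * exp (- (1 / x)) else 0)"

lemma flat_tendsto_0: "(flat k \<longlongrightarrow> 0) (at 0)"
proof -
  have "((\<lambda>x::real. (1 / x) ^ k / exp (1 / x)) \<longlongrightarrow> 0) (at_right 0)"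
    using filterlim_compose[OF tendsto_power_div_exp_0 filterlim_inverse_at_top_right]
    by (simp add: inverse_eq_divide)
  then have "(flat k \<longlongrightarrow> 0) (at_right 0)"
    by (rule Lim_transform_eventually)
       (auto simp: flat_def exp_minus divide_inverse eventually_at_right_less
             intro!: eventually_mono[OF eventually_at_right_less])
  moreover have "(flat k \<longlongrightarrow> 0) (at_left 0)"
    by (rule Lim_transform_eventually[OF tendsto_const])
       (auto simp: flat_def intro!: eventually_mono[OF eventually_at_left_real[of "-1" 0]])
  ultimately show ?thesis
    by (simp add: filterlim_split_at)
qed

text \<open>The powers of \<open>1 / x\<close> in front of \<open>exp (- (1 / x))\<close> make the
  family closed under differentiation up to linear combinations; this is what the index
  \<open>k\<close> is for. At 0 the difference quotient of \<open>flat k\<close> is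
  \<open>flat (k + 1)\<close>, which tends to 0.\<close>

lemma flat_has_derivative:
  "(flat k has_real_derivative (flat (k + 2) x - real k * flat (k + 1) x)) (at x)"
proof (cases x "0 :: real" rule: linorder_cases)
  case less
  have "((\<lambda>_. 0) has_real_derivative 0) (at x)"
    by simp
  then have "(flat k has_real_derivative 0) (at x)"
    by (rule DERIV_cong_ev[THEN iffD1, rotated 3])
       (use less in \<open>auto simp: flat_def intro!: eventually_mono[OF eventually_nhds_in_open[of "{..<0}"]]\<close>)
  with less show ?thesis
    by (simp add: flat_def)
next
  case equal
  have "((\<lambda>h. flat (k + 1) h) \<longlongrightarrow> 0) (at 0)"
    by (rule flat_tendsto_0)
  then have "((\<lambda>h. (flat k (0 + h) - flat k 0) / h) \<longlongrightarrow> 0) (at 0)"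
    by (rule Lim_transform_eventually) (auto simp: flat_def eventually_at_filter)
  with equal show ?thesis
    by (simp add: DERIV_def flat_def)
next
  case greater
  have "((\<lambda>x. (1 / x) ^ k * exp (- (1 / x))) has_real_derivative
          flat (k + 2) x - real k * flat (k + 1) x) (at x)"
    using greater
    by (auto intro!: derivative_eq_intros simp: flat_def power_one_over divide_simps power2_eq_square)
       (cases k; simp add: algebra_simps)
  then show ?thesis
    by (rule DERIV_cong_ev[THEN iffD1, rotated 3])
       (use greater in \<open>auto simp: flat_def intro!: eventually_mono[OF eventually_nhds_in_open[of "{0<..}"]]\<close>)
qed

text \<open>An algebra that contains the derivatives of its members, so that the differentiability
  of every order demanded by \<open>test_functions\<close> follows from membership alone. The affine
  arguments allow cut-offs from both sides and rescaling.\<close>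

inductive_set smooth_alg :: "(real \<Rightarrow> real) set" where
  flat: "(\<lambda>x. flat k (s * x + t)) \<in> smooth_alg"
| const: "(\<lambda>_. r) \<in> smooth_alg"
| add: "f \<in> smooth_alg \<Longrightarrow> g \<in> smooth_alg \<Longrightarrow> (\<lambda>x. f x + g x) \<in> smooth_alg"
| mult: "f \<in> smooth_alg \<Longrightarrow> g \<in> smooth_alg \<Longrightarrow> (\<lambda>x. f x * g x) \<in> smooth_alg"

lemma smooth_alg_has_derivative:
  assumes "f \<in> smooth_alg"
  shows "\<exists>f'\<in>smooth_alg. \<forall>x. (f has_real_derivative f' x) (at x)"
  using assms
proof induction
  case (flat k s t)
  have "((\<lambda>x. flat k (s * x + t)) has_real_derivative
          (s * flat (k + 2) (s * x + t) + (- s * real k) * flat (k + 1) (s * x + t))) (at x)" for x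
    using DERIV_chain2[where f = "flat k" and g = "\<lambda>x. s * x + t" and x = x, OF flat_has_derivative]
      DERIV_add[OF DERIV_cmult_Id[of s x UNIV] DERIV_const[of t]]
    by (simp add: algebra_simps)
  moreover have "(\<lambda>x. s * flat (k + 2) (s * x + t) + (- s * real k) * flat (k + 1) (s * x + t)) \<in> smooth_alg"
    by (intro smooth_alg.intros)
  ultimately show ?case
    by (intro bexI[of _ "\<lambda>x. s * flat (k + 2) (s * x + t) + (- s * real k) * flat (k + 1) (s * x + t)"]) auto
next
  case (const r)
  then show ?case
    by (intro bexI[of _ "\<lambda>_. 0"] smooth_alg.intros) auto
next
  case (add f g)
  then obtain f' g' where "f' \<in> smooth_alg" "\<And>x. (f has_real_derivative f' x) (at x)"
    "g' \<in> smooth_alg" "\<And>x. (g has_real_derivative g' x) (at x)"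
    by blast
  then show ?case
    by (intro bexI[of _ "\<lambda>x. f' x + g' x"]) (auto intro!: derivative_intros smooth_alg.intros)
next
  case (mult f g)
  then obtain f' g' where "f' \<in> smooth_alg" "\<And>x. (f has_real_derivative f' x) (at x)"
    "g' \<in> smooth_alg" "\<And>x. (g has_real_derivative g' x) (at x)"
    by blast
  with mult show ?case
    by (intro bexI[of _ "\<lambda>x. f' x * g x + g' x * f x"]) (auto intro!: derivative_intros smooth_alg.intros)
qed

lemma smooth_alg_deriv:
  assumes "f \<in> smooth_alg"
  shows "f differentiable at x" "deriv f \<in> smooth_alg"
proof -
  obtain f' where f': "f' \<in> smooth_alg" "\<And>x. (f has_real_derivative f' x) (at x)"
    using smooth_alg_has_derivative[OF assms] by blast
  then have "deriv f = f'"
    by (auto simp: DERIV_imp_deriv)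
  with f' show "f differentiable at x" "deriv f \<in> smooth_alg"
    by (auto simp: real_differentiable_def)
qed

lemma smooth_alg_funpow_deriv: "f \<in> smooth_alg \<Longrightarrow> (deriv ^^ m) f \<in> smooth_alg"
  by (induction m) (auto intro: smooth_alg_deriv)

lemma continuous_on_smooth_alg: "f \<in> smooth_alg \<Longrightarrow> continuous_on S f"
  by (meson continuous_at_imp_continuous_on differentiable_imp_continuous_within smooth_alg_deriv(1))

text \<open>Membership in the algebra is asked of the derivative only, because the rule also has to
  cover antiderivatives of bumps, which are given as integrals. The bound \<open>a\<close> away from
  0 keeps the closed support inside the open half-line.\<close>

lemma test_functionsI:
  assumes "\<And>x. \<phi> differentiable at x" "deriv \<phi> \<in> smooth_alg"
    and "0 < a" "\<And>x. x < a \<Longrightarrow> \<phi> x = 0" "\<And>x. x > b \<Longrightarrow> \<phi> x = 0"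
  shows "\<phi> \<in> test_functions"
proof -
  have "(deriv ^^ m) \<phi> differentiable at x" for m x
  proof (cases m)
    case (Suc m')
    then have "(deriv ^^ m) \<phi> = (deriv ^^ m') (deriv \<phi>)"
      by (simp only: Suc funpow_Suc_right o_apply)
    with assms(2) show ?thesis
      by (simp add: smooth_alg_deriv smooth_alg_funpow_deriv)
  qed (use assms in auto)
  moreover have sub: "closure {x. \<phi> x \<noteq> 0} \<subseteq> {a..b}"
    by (rule closure_minimal) (use assms(4,5) in \<open>auto simp: not_less[symmetric]\<close>)
  moreover have "compact (closure {x. \<phi> x \<noteq> 0})"
    using compact_Int_closed[of "{a..b}" "closure {x. \<phi> x \<noteq> 0}"] sub by (simp add: Int_absorb1)
  moreover have "{a..b} \<subseteq> {0<..}"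
    using assms(3) by auto
  ultimately show ?thesis
    unfolding test_functions_def by blast
qed

text \<open>A product of two one-sided cut-offs. The factor \<open>Suc m\<close> stretches their
  arguments, so that both tend to 1 inside the interval and the bumps approximate its indicator
  pointwise without any mollification.\<close>

definition bump :: "real \<Rightarrow> real \<Rightarrow> nat \<Rightarrow> real \<Rightarrow> real" where
  "bump a b m x = flat 0 (real (Suc m) * (x - a)) * flat 0 (real (Suc m) * (b - x))"

lemma bump_smooth_alg: "bump a b m \<in> smooth_alg"
proof -
  have "bump a b m = (\<lambda>x. flat 0 (real (Suc m) * x + (- real (Suc m) * a)) *
                         flat 0 (- real (Suc m) * x + real (Suc m) * b))"
    unfolding bump_def by (intro ext arg_cong2[of _ _ _ _ "(*)"] arg_cong[of _ _ "flat 0"]) (auto simp: algebra_simps)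
  also have "\<dots> \<in> smooth_alg"
    by (intro smooth_alg.intros)
  finally show ?thesis .
qed

lemma bump_eq_0: "x \<le> a \<or> b \<le> x \<Longrightarrow> bump a b m x = 0"
  by (auto simp: bump_def flat_def zero_less_mult_iff)

lemma bump_nonneg: "0 \<le> bump a b m x" and bump_le_1: "bump a b m x \<le> 1"
  by (auto simp: bump_def flat_def zero_less_mult_iff intro!: mult_le_one)

lemma bump_shift: "bump (a + d) (b + d) m x = bump a b m (x - d)"
  by (simp add: bump_def algebra_simps)

lemma bump_tendsto_indicator: "(\<lambda>m. bump a b m x) \<longlonglongrightarrow> indicator {a<..<b} x"
proof (cases "a < x \<and> x < b")
  case True
  have *: "(\<lambda>m. flat 0 (real (Suc m) * y)) \<longlonglongrightarrow> 1" if "y > 0" for y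
  proof -
    have "(\<lambda>m. exp (- (inverse (real (Suc m)) * (1 / y)))) \<longlonglongrightarrow> exp (- (0 * (1 / y)))"
      by (intro tendsto_intros LIMSEQ_inverse_real_of_nat)
    with that show ?thesis
      by (simp add: flat_def zero_less_mult_iff divide_inverse)
  qed
  show ?thesis
    using tendsto_mult[OF *[of "x - a"] *[of "b - x"]] True by (simp add: bump_def)
next
  case False
  then have "bump a b m x = 0" for m
    by (intro bump_eq_0) auto
  with False show ?thesis
    by (auto simp: indicator_def)
qed

lemma bump_test: "0 < a \<Longrightarrow> bump a b m \<in> test_functions"
  by (rule test_functionsI[of _ a b]) (auto intro: smooth_alg_deriv bump_smooth_alg bump_eq_0)

text \<open>A compactly supported antiderivative exists only for functions with vanishing integral.
  A bump minus its translate has this property, and such test functions suffice to show that a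
  function with weak derivative 0 is invariant under translations.\<close>

lemma bump_difference_antiderivative:
  assumes "0 < a" "a < b" "0 \<le> d"
  shows "\<exists>\<phi>\<in>test_functions. \<forall>x. deriv \<phi> x = bump a b m x - bump (a + d) (b + d) m x"
proof -
  define \<Phi> where "\<Phi> x = integral {0..x} (bump a b m)" for x
  have cont: "continuous_on S (bump a b m)" for S
    by (rule continuous_on_smooth_alg[OF bump_smooth_alg])
  have zero: "\<Phi> x = 0" if "x \<le> a" for x
    unfolding \<Phi>_def by (rule integral_unique has_integral_is_0)+
      (use that in \<open>auto intro: bump_eq_0\<close>)
  have const: "\<Phi> x = \<Phi> b" if "b \<le> x" for x
  proof -
    have "\<Phi> b + integral {b..x} (bump a b m) = \<Phi> x"
      unfolding \<Phi>_def using assms that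
      by (intro Henstock_Kurzweil_Integration.integral_combine integrable_continuous_real cont) auto
    moreover have "integral {b..x} (bump a b m) = 0"
      by (rule integral_unique, rule has_integral_is_0) (auto intro: bump_eq_0)
    ultimately show ?thesis by simp
  qed
  have deriv: "(\<Phi> has_real_derivative bump a b m x) (at x)" for x
  proof (cases "x < a")
    case True
    have "((\<lambda>_. 0) has_real_derivative 0) (at x)"
      by simp
    then have "(\<Phi> has_real_derivative 0) (at x)"
      by (rule DERIV_cong_ev[THEN iffD1, rotated 3])
         (use True in \<open>auto simp: zero intro!: eventually_mono[OF eventually_nhds_in_open[of "{..<a}"]]\<close>)
    with True show ?thesis
      by (simp add: bump_eq_0)
  next
    case False
    then have "(\<Phi> has_real_derivative bump a b m x) (at x within {0..x+1})"
      unfolding \<Phi>_def using assms by (intro integral_has_real_derivative cont) auto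
    moreover have "at x within {0..x+1} = at x"
      by (rule at_within_interior) (use False assms in auto)
    ultimately show ?thesis by simp
  qed
  \<comment> \<open>Since \<open>\<Phi>\<close> is constant beyond \<open>b\<close>, subtracting its
    translate cancels it beyond \<open>b + d\<close>.\<close>
  define \<phi> where "\<phi> x = \<Phi> x - \<Phi> (x - d)" for x
  have d: "(\<phi> has_real_derivative bump a b m x - bump (a + d) (b + d) m x) (at x)" for x
    unfolding \<phi>_def bump_shift
    by (rule derivative_eq_intros deriv DERIV_chain2[OF deriv] | simp)+
  then have eq: "deriv \<phi> = (\<lambda>x. bump a b m x + (-1) * bump (a + d) (b + d) m x)"
    by (auto simp: DERIV_imp_deriv)
  show ?thesis
  proof (intro bexI allI)
    show "\<phi> \<in> test_functions"
    proof (rule test_functionsI)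
      show "deriv \<phi> \<in> smooth_alg"
        unfolding eq by (intro smooth_alg.intros bump_smooth_alg)
      show "\<phi> x = 0" if "x < a" for x
        using that assms by (simp add: \<phi>_def zero)
      show "\<phi> x = 0" if "x > b + d" for x
        using that assms const[of x] const[of "x - d"] by (simp add: \<phi>_def)
    qed (use d assms in \<open>auto simp: real_differentiable_def\<close>)
  qed (simp add: eq)
qed

subsection \<open>Absolutely continuous functions on the half-line\<close>

text \<open>Local absolute continuity on the closed half-line. The density enters only as an
  integrand, so that no differentiability almost everywhere has to be established.\<close>

definition abs_cont :: "(real \<Rightarrow> complex) \<Rightarrow> (real \<Rightarrow> complex) \<Rightarrow> bool" where
  "abs_cont f f' \<longleftrightarrow>
     (\<forall>x\<ge>0. set_integrable lborel {0<..x} f' \<and> f x = f 0 + (LINT y:{0<..x}|lborel. f' y))"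

lemma abs_contD:
  assumes "abs_cont f f'" "0 \<le> x"
  shows "set_integrable lborel {0<..x} f'" "f x = f 0 + (LINT y:{0<..x}|lborel. f' y)"
  using assms unfolding abs_cont_def by blast+

lemma set_integral_Ioc_eq:
  fixes f :: "real \<Rightarrow> complex"
  assumes "set_integrable lborel {0<..x} f"
  shows "f integrable_on {0..x}" "(LINT y:{0<..x}|lborel. f y) = integral {0..x} f"
proof -
  have neg: "negligible {y \<in> {0<..x} - {0..x}. f y \<noteq> 0}" "negligible {y \<in> {0..x} - {0<..x}. f y \<noteq> 0}"
    by (rule negligible_subset[of "{0}"]; auto)+
  show "f integrable_on {0..x}"
    using set_borel_integral_eq_integral(1)[OF assms] integrable_spike_set neg by blast
  show "(LINT y:{0<..x}|lborel. f y) = integral {0..x} f"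
    using set_borel_integral_eq_integral(2)[OF assms] integral_spike_set[OF neg] by simp
qed

lemma abs_cont_integral:
  assumes "abs_cont f f'" "0 \<le> x"
  shows "f' integrable_on {0..x}" "f x = f 0 + integral {0..x} f'"
  using assms set_integral_Ioc_eq[of x f'] unfolding abs_cont_def by metis+


text \<open>Continuity and derivatives are local, so the half-line may be exchanged for a compact
  interval, where the fundamental theorem of calculus applies.\<close>

lemma at_within_half_line:
  assumes "0 \<le> x"
  shows "at x within {0..} = at x within {0..x+1::real}"
  by (rule at_within_nhd[of _ "{..<x+1}"]) (use assms in auto)

lemma abs_cont_continuous_on:
  assumes "abs_cont f f'"
  shows "continuous_on {0..} f"
  unfolding continuous_on_eq_continuous_within
proof
  fix x :: real assume "x \<in> {0..}"
  then have x: "0 \<le> x" by simp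
  have "continuous_on {0..x+1} (\<lambda>y. f 0 + integral {0..y} f')"
    using x by (intro continuous_intros indefinite_integral_continuous_1 abs_cont_integral(1)[OF assms]) auto
  then have "continuous_on {0..x+1} f"
    by (rule continuous_on_eq) (simp add: abs_cont_integral(2)[OF assms, symmetric])
  then show "continuous (at x within {0..}) f"
    unfolding at_within_half_line[OF x] continuous_on_eq_continuous_within using x by auto
qed

lemma abs_cont_has_derivative:
  assumes "abs_cont f f'" "continuous_on {0..} f'" "0 \<le> x"
  shows "(f has_vector_derivative f' x) (at x within {0..})"
proof -
  have "((\<lambda>y. integral {0..y} f') has_vector_derivative f' x) (at x within {0..x+1})"
    by (rule integral_has_vector_derivative) (use assms continuous_on_subset[OF assms(2)] in auto)
  then have "((\<lambda>y. f 0 + integral {0..y} f') has_vector_derivative f' x) (at x within {0..x+1})"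
    by (auto intro!: derivative_eq_intros)
  then have "(f has_vector_derivative f' x) (at x within {0..x+1})"
    by (rule has_vector_derivative_transform[rotated 2])
       (use assms(3) in \<open>simp_all add: abs_cont_integral(2)[OF assms(1), symmetric]\<close>)
  then show ?thesis
    unfolding at_within_half_line[OF assms(3)] .
qed

lemma abs_contI_C1:
  assumes "\<And>x. 0 \<le> x \<Longrightarrow> (f has_vector_derivative f' x) (at x within {0..})" "continuous_on {0..} f'"
  shows "abs_cont f f'"
  unfolding abs_cont_def
proof (intro allI impI conjI)
  fix x :: real assume x: "0 \<le> x"
  have "set_integrable lborel {0..x} f'"
    by (rule borel_integrable_atLeastAtMost') (auto intro: continuous_on_subset[OF assms(2)])
  then show i: "set_integrable lborel {0<..x} f'"
    by (rule set_integrable_subset) auto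
  have "(f' has_integral (f x - f 0)) {0..x}"
    using x by (intro fundamental_theorem_of_calculus)
       (auto intro: has_vector_derivative_within_subset[OF assms(1)])
  then show "f x = f 0 + (LINT y:{0<..x}|lborel. f' y)"
    using set_integral_Ioc_eq(2)[OF i] by (simp add: integral_unique)
qed

lemma abs_cont_add:
  assumes "abs_cont f f'" "abs_cont g g'"
  shows "abs_cont (\<lambda>x. f x + g x) (\<lambda>x. f' x + g' x)"
  unfolding abs_cont_def
proof (intro allI impI)
  fix x :: real assume "0 \<le> x"
  note f = abs_contD[OF assms(1) this] and g = abs_contD[OF assms(2) this]
  show "set_integrable lborel {0<..x} (\<lambda>x. f' x + g' x) \<and>
      f x + g x = f 0 + g 0 + (LINT y:{0<..x}|lborel. f' y + g' y)"
    using f(1) g(1) by (subst f(2), subst g(2)) simp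
qed

lemma abs_cont_cmult:
  assumes "abs_cont f f'"
  shows "abs_cont (\<lambda>x. r * f x) (\<lambda>x. r * f' x)"
  unfolding abs_cont_def
proof (intro allI impI)
  fix x :: real assume "0 \<le> x"
  note f = abs_contD[OF assms(1) this]
  show "set_integrable lborel {0<..x} (\<lambda>x. r * f' x) \<and>
      r * f x = r * f 0 + (LINT y:{0<..x}|lborel. r * f' y)"
    using f(1) by (subst f(2)) (simp add: distrib_left)
qed

lemma abs_cont_diff:
  assumes "abs_cont f f'" "abs_cont g g'"
  shows "abs_cont (\<lambda>x. f x - g x) (\<lambda>x. f' x - g' x)"
  using abs_cont_add[OF assms(1) abs_cont_cmult[OF assms(2), of "- 1"]] by simp

lemma set_integrable_cnj_iff: "set_integrable M A (\<lambda>x. cnj (f x)) \<longleftrightarrow> set_integrable M A f"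
  using complex_integrable_cnj[of M "\<lambda>x. indicator A x *\<^sub>R f x"] by (simp add: set_integrable_def)

lemma set_integral_cnj: "(LINT x:A|M. cnj (f x)) = cnj (LINT x:A|M. f x)"
  using Bochner_Integration.integral_cnj[of M "\<lambda>x. indicator A x *\<^sub>R f x"]
  by (simp add: set_lebesgue_integral_def)

lemma abs_cont_cnj:
  assumes "abs_cont f f'"
  shows "abs_cont (\<lambda>x. cnj (f x)) (\<lambda>x. cnj (f' x))"
  unfolding abs_cont_def set_integrable_cnj_iff set_integral_cnj
proof (intro allI impI)
  fix x :: real assume "0 \<le> x"
  note f = abs_contD[OF assms(1) this]
  show "set_integrable lborel {0<..x} f' \<and> cnj (f x) = cnj (f 0) + cnj (LINT y:{0<..x}|lborel. f' y)"
    using f(1) by (subst f(2)) simp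
qed

lemma set_borel_measurable_AE_cong:
  fixes f g :: "real \<Rightarrow> complex"
  assumes "set_borel_measurable lborel A f" "set_borel_measurable lborel A g"
    and "AE x in lborel. x \<in> A \<longrightarrow> f x = g x"
  shows "set_integrable lborel A f \<longleftrightarrow> set_integrable lborel A g"
    and "(LINT x:A|lborel. f x) = (LINT x:A|lborel. g x)"
proof -
  have "AE x in lborel. indicat_real A x *\<^sub>R f x = indicat_real A x *\<^sub>R g x"
    using assms(3) by eventually_elim (auto simp: indicator_def)
  with assms(1,2) show "set_integrable lborel A f \<longleftrightarrow> set_integrable lborel A g"
    "(LINT x:A|lborel. f x) = (LINT x:A|lborel. g x)"
    unfolding set_borel_measurable_def set_integrable_def set_lebesgue_integral_def
    by (rule integrable_cong_AE integral_cong_AE)+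
qed

section \<open>Products and integration by parts\<close>

lemma set_integrable_mult_continuous:
  fixes f g :: "real \<Rightarrow> complex"
  assumes f: "set_integrable lborel {0<..T} f" and g: "continuous_on {0..T} g"
  shows "set_integrable lborel {0<..T} (\<lambda>x. f x * g x)"
proof -
  have "bounded (g ` {0..T})"
    using g by (intro compact_imp_bounded compact_continuous_image) auto
  then obtain B where B: "\<And>x. x \<in> {0..T} \<Longrightarrow> cmod (g x) \<le> B"
    unfolding bounded_iff by blast
  have "(\<lambda>x. indicat_real {0<..T} x *\<^sub>R f x) \<in> borel_measurable lborel"
    using f unfolding set_integrable_def by (rule borel_measurable_integrable)
  moreover have "(\<lambda>x. indicat_real {0..T} x *\<^sub>R g x) \<in> borel_measurable lborel"
    using borel_measurable_continuous_on_indicator[OF _ g] by simp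
  ultimately have "(\<lambda>x. (indicat_real {0<..T} x *\<^sub>R f x) * (indicat_real {0..T} x *\<^sub>R g x)) \<in> borel_measurable lborel"
    by (rule borel_measurable_times)
  also have "(\<lambda>x. (indicat_real {0<..T} x *\<^sub>R f x) * (indicat_real {0..T} x *\<^sub>R g x))
      = (\<lambda>x. indicat_real {0<..T} x *\<^sub>R (f x * g x))"
    by (auto simp: indicator_def)
  finally have "set_borel_measurable lborel {0<..T} (\<lambda>x. f x * g x)"
    by (simp add: set_borel_measurable_def)
  moreover have "set_integrable lborel {0<..T} (\<lambda>x. complex_of_real B * f x)"
    using f by simp
  moreover have "cmod (f x * g x) \<le> cmod (complex_of_real B * f x)" if "x \<in> {0<..T}" for x
  proof -
    have "cmod (g x) \<le> \<bar>B\<bar>" using B[of x] that by auto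
    then show ?thesis by (simp add: norm_mult mult.commute[of "cmod (f x)"] mult_right_mono)
  qed
  ultimately show ?thesis
    by (intro set_integrable_bound[where g = "\<lambda>x. f x * g x"]) auto
qed

text \<open>Fubini on the square \<open>(0,T]\<^sup>2\<close>, cut along its diagonal.\<close>

lemma iterated_set_integral_triangles:
  fixes p q :: "real \<Rightarrow> complex"
  assumes p: "set_integrable lborel {0<..T} p" and q: "set_integrable lborel {0<..T} q"
  shows "(LINT y:{0<..T}|lborel. (LINT x:{0<..y}|lborel. p x) * q y) +
         (LINT x:{0<..T}|lborel. p x * (LINT y:{0<..x}|lborel. q y))
       = (LINT x:{0<..T}|lborel. p x) * (LINT y:{0<..T}|lborel. q y)"
proof -
  define P where "P x = indicat_real {0<..T} x *\<^sub>R p x" for x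
  define Q where "Q x = indicat_real {0<..T} x *\<^sub>R q x" for x
  have iP: "integrable lborel P" and iQ: "integrable lborel Q"
    using p q by (simp_all add: set_integrable_def P_def[abs_def] Q_def[abs_def])
  have [measurable]: "P \<in> borel_measurable lborel" "Q \<in> borel_measurable lborel"
    using iP iQ by auto
  have i: "integrable (lborel \<Otimes>\<^sub>M lborel) (\<lambda>z. P (fst z) * Q (snd z))"
  proof (rule lborel_pair.Fubini_integrable)
    show "integrable lborel (\<lambda>x. LINT y|lborel. norm (P (fst (x, y)) * Q (snd (x, y))))"
      using iP by (simp add: norm_mult)
  qed (use iQ in auto)
  have le: "{z. fst z \<le> snd z} \<in> sets (lborel \<Otimes>\<^sub>M lborel :: (real \<times> real) measure)"
    and lt: "{z. snd z < fst z} \<in> sets (lborel \<Otimes>\<^sub>M lborel :: (real \<times> real) measure)"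
    unfolding lborel_prod sets_lborel
    by (rule borel_closed borel_open, intro closed_Collect_le open_Collect_less continuous_intros)+
  have i1: "integrable (lborel \<Otimes>\<^sub>M lborel) (\<lambda>(x, y). indicat_real {z. fst z \<le> snd z} (x, y) *\<^sub>R (P x * Q y))"
    using integrable_mult_indicator[OF le i] by (simp only: split_beta' prod.collapse)
  have i2: "integrable (lborel \<Otimes>\<^sub>M lborel) (\<lambda>(x, y). indicat_real {z. snd z < fst z} (x, y) *\<^sub>R (P x * Q y))"
    using integrable_mult_indicator[OF lt i] by (simp only: split_beta' prod.collapse)
  have lower: "(LINT x|lborel. indicat_real {z. fst z \<le> snd z} (x, y) *\<^sub>R (P x * Q y))
      = indicat_real {0<..T} y *\<^sub>R ((LINT x:{0<..y}|lborel. p x) * q y)" for y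
  proof -
    have "(\<lambda>x. indicat_real {z. fst z \<le> snd z} (x, y) *\<^sub>R (P x * Q y))
        = (\<lambda>x. (indicat_real {0<..y} x *\<^sub>R p x) * Q y)"
      by (auto simp: P_def Q_def indicator_def)
    then have "(LINT x|lborel. indicat_real {z. fst z \<le> snd z} (x, y) *\<^sub>R (P x * Q y))
        = (LINT x:{0<..y}|lborel. p x) * Q y"
      by (simp only: set_lebesgue_integral_def integral_mult_left_zero)
    then show ?thesis
      by (simp add: Q_def)
  qed
  have upper: "(LINT y|lborel. indicat_real {z. snd z < fst z} (x, y) *\<^sub>R (P x * Q y))
      = indicat_real {0<..T} x *\<^sub>R (p x * (LINT y:{0<..x}|lborel. q y))" for x
  proof -
    \<comment> \<open>The strict triangle omits the diagonal point \<open>y = x\<close> that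
      \<open>{0<..x}\<close> contains; a single point does not change the integral.\<close>
    have "(LINT y|lborel. indicat_real {z. snd z < fst z} (x, y) *\<^sub>R (P x * Q y))
        = (LINT y|lborel. P x * (indicat_real {0<..x} y *\<^sub>R q y))"
      by (rule integral_discrete_difference[of "{x}"]) (auto simp: P_def Q_def indicator_def)
    also have "\<dots> = P x * (LINT y:{0<..x}|lborel. q y)"
      by (simp only: set_lebesgue_integral_def integral_mult_right_zero)
    finally show ?thesis
      by (simp add: P_def)
  qed
  have "(LINT x|lborel. P x) * (LINT y|lborel. Q y) = (LINT x|lborel. LINT y|lborel. P x * Q y)"
    by simp
  also have "\<dots> = (LINT z|(lborel \<Otimes>\<^sub>M lborel). P (fst z) * Q (snd z))"
    using lborel_pair.integral_fst'[OF i] by simp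
  also have "\<dots> = (LINT z|(lborel \<Otimes>\<^sub>M lborel). (case z of (x, y) \<Rightarrow> indicat_real {z. fst z \<le> snd z} (x, y) *\<^sub>R (P x * Q y)) +
                    (case z of (x, y) \<Rightarrow> indicat_real {z. snd z < fst z} (x, y) *\<^sub>R (P x * Q y)))"
    by (rule Bochner_Integration.integral_cong) (auto simp: indicator_def)
  also have "\<dots> = (LINT y|lborel. LINT x|lborel. indicat_real {z. fst z \<le> snd z} (x, y) *\<^sub>R (P x * Q y)) +
                  (LINT x|lborel. LINT y|lborel. indicat_real {z. snd z < fst z} (x, y) *\<^sub>R (P x * Q y))"
    using i1 i2 by (simp add: lborel_pair.integral_snd lborel_pair.integral_fst)
  finally show ?thesis
    unfolding lower upper by (simp add: set_lebesgue_integral_def P_def Q_def)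
qed

text \<open>With \<open>f\<close> and \<open>g\<close> written as initial value plus indefinite
  integral, the only term that is not linear is the product of the two indefinite integrals, and for
  it the rule is Fubini on the square cut along the diagonal. Integrable densities are enough, as
  needed for weak second derivatives.\<close>

lemma abs_cont_mult:
  assumes f: "abs_cont f p" and g: "abs_cont g q"
  shows "abs_cont (\<lambda>x. f x * g x) (\<lambda>x. p x * g x + f x * q x)"
  unfolding abs_cont_def
proof (intro allI impI)
  fix T :: real assume T: "0 \<le> T"
  have p: "set_integrable lborel {0<..T} p" and q: "set_integrable lborel {0<..T} q"
    using f g T by (auto intro: abs_contD)
  have cont: "continuous_on {0..T} f" "continuous_on {0..T} g"
    using abs_cont_continuous_on[OF f] abs_cont_continuous_on[OF g]
    by (auto intro: continuous_on_subset)
  define P where "P x = (LINT y:{0<..x}|lborel. p y)" for x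
  define Q where "Q x = (LINT y:{0<..x}|lborel. q y)" for x
  have fP: "P x = f x - f 0" and gQ: "Q x = g x - g 0" if "0 \<le> x" for x
    unfolding P_def Q_def
    by (subst abs_contD(2)[OF f that], simp) (subst abs_contD(2)[OF g that], simp)
  have pg: "set_integrable lborel {0<..T} (\<lambda>x. p x * g x)"
    by (rule set_integrable_mult_continuous[OF p cont(2)])
  have fq: "set_integrable lborel {0<..T} (\<lambda>x. f x * q x)"
    using set_integrable_mult_continuous[OF q cont(1)] by (simp add: mult.commute)
  have contPQ: "continuous_on {0..T} P" "continuous_on {0..T} Q"
    by (rule continuous_on_eq[of _ "\<lambda>x. f x - f 0"] continuous_on_eq[of _ "\<lambda>x. g x - g 0"];
        use fP gQ in \<open>auto intro!: continuous_intros cont\<close>)+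
  have pQ: "set_integrable lborel {0<..T} (\<lambda>x. p x * Q x)"
    by (rule set_integrable_mult_continuous[OF p contPQ(2)])
  have Pq: "set_integrable lborel {0<..T} (\<lambda>x. P x * q x)"
    using set_integrable_mult_continuous[OF q contPQ(1)] by (simp add: mult.commute)
  have "(LINT x:{0<..T}|lborel. p x * g x + f x * q x)
      = (LINT x:{0<..T}|lborel. (p x * g 0 + f 0 * q x) + (P x * q x + p x * Q x))"
    by (rule set_lebesgue_integral_cong) (auto simp: algebra_simps fP gQ)
  also have "\<dots> = P T * g 0 + f 0 * Q T + P T * Q T"
    using p q pQ Pq iterated_set_integral_triangles[OF p q, folded P_def Q_def]
    by (simp add: P_def[symmetric] Q_def[symmetric])
  finally show "set_integrable lborel {0<..T} (\<lambda>x. p x * g x + f x * q x) \<and>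
      f T * g T = f 0 * g 0 + (LINT x:{0<..T}|lborel. p x * g x + f x * q x)"
    using pg fq fP[OF T] gQ[OF T] by (simp add: algebra_simps)
qed

subsection \<open>Weak derivatives on the half-line\<close>

text \<open>Integrability reaches down to the vertex, not merely over compact subsets of the open
  half-line: indefinite integrals starting at 0, and with them the values at the vertex, depend on
  it.\<close>

definition loc_int :: "(real \<Rightarrow> complex) \<Rightarrow> bool" where
  "loc_int f \<longleftrightarrow> (\<forall>x. set_integrable lborel {0<..x} f)"

section \<open>Measurability and square-integrable functions\<close>

lemma set_borel_measurable_mult:
  fixes f g :: "real \<Rightarrow> complex"
  assumes "set_borel_measurable lborel A f" "set_borel_measurable lborel A g"
  shows "set_borel_measurable lborel A (\<lambda>x. f x * g x)"
proof -
  have "(\<lambda>x. (indicat_real A x *\<^sub>R f x) * (indicat_real A x *\<^sub>R g x)) \<in> borel_measurable lborel"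
    using assms unfolding set_borel_measurable_def by (rule borel_measurable_times)
  also have "(\<lambda>x. (indicat_real A x *\<^sub>R f x) * (indicat_real A x *\<^sub>R g x)) = (\<lambda>x. indicat_real A x *\<^sub>R (f x * g x))"
    by (auto simp: indicator_def)
  finally show ?thesis
    by (simp add: set_borel_measurable_def)
qed

lemma set_borel_measurable_add:
  fixes f g :: "real \<Rightarrow> complex"
  assumes "set_borel_measurable lborel A f" "set_borel_measurable lborel A g"
  shows "set_borel_measurable lborel A (\<lambda>x. f x + g x)"
  using assms unfolding set_borel_measurable_def scaleR_add_right by (rule borel_measurable_add)

lemma set_borel_measurable_cmult:
  fixes f :: "real \<Rightarrow> complex"
  assumes "set_borel_measurable lborel A f"
  shows "set_borel_measurable lborel A (\<lambda>x. r * f x)"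
  using borel_measurable_times[OF borel_measurable_const[of r] assms[unfolded set_borel_measurable_def]]
  by (simp add: set_borel_measurable_def)

lemma set_borel_measurable_cnj:
  fixes f :: "real \<Rightarrow> complex"
  assumes "set_borel_measurable lborel A f"
  shows "set_borel_measurable lborel A (\<lambda>x. cnj (f x))"
proof -
  have "(\<lambda>x. cnj (indicat_real A x *\<^sub>R f x)) \<in> borel_measurable lborel"
    by (rule measurable_compose[OF assms[unfolded set_borel_measurable_def]])
       (intro borel_measurable_continuous_onI continuous_intros)
  then show ?thesis
    by (simp add: set_borel_measurable_def)
qed

lemma set_borel_measurable_cmod_power2:
  fixes f :: "real \<Rightarrow> complex"
  assumes "set_borel_measurable lborel A f"
  shows "set_borel_measurable lborel A (\<lambda>x. (cmod (f x))\<^sup>2)"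
proof -
  have "(\<lambda>x. (cmod (indicat_real A x *\<^sub>R f x))\<^sup>2) \<in> borel_measurable lborel"
    using assms unfolding set_borel_measurable_def by measurable
  also have "(\<lambda>x. (cmod (indicat_real A x *\<^sub>R f x))\<^sup>2) = (\<lambda>x. indicat_real A x *\<^sub>R (cmod (f x))\<^sup>2)"
    by (auto simp: indicator_def)
  finally show ?thesis
    by (simp add: set_borel_measurable_def)
qed

lemma set_borel_measurable_half_line:
  fixes f :: "real \<Rightarrow> complex"
  assumes "continuous_on {0..} f"
  shows "set_borel_measurable lborel {0<..} f"
proof -
  have "continuous_on {0<..} f"
    by (rule continuous_on_subset[OF assms]) auto
  then show ?thesis
    using set_measurable_continuous_on[of "{0<..}" f] by (simp add: set_borel_measurable_def)
qed

lemma L2D: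
  assumes "f \<in> L2"
  shows "set_borel_measurable lborel {0<..} f" "set_integrable lborel {0<..} (\<lambda>x. (cmod (f x))\<^sup>2)"
  using assms by (auto simp: L2_def)

lemma L2_bound:
  assumes "set_borel_measurable lborel {0<..} f" "set_integrable lborel {0<..} g"
    and "\<And>x. 0 < x \<Longrightarrow> (cmod (f x))\<^sup>2 \<le> (g x :: real)"
  shows "f \<in> L2"
proof -
  have "set_integrable lborel {0<..} (\<lambda>x. (cmod (f x))\<^sup>2)"
  proof (rule set_integrable_bound[OF assms(2) set_borel_measurable_cmod_power2[OF assms(1)]])
    show "AE x in lborel. x \<in> {0<..} \<longrightarrow> norm ((cmod (f x))\<^sup>2) \<le> norm (g x)"
      using assms(3) by (intro AE_I2) (fastforce intro: order_trans[OF _ abs_ge_self])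
  qed
  with assms(1) show ?thesis
    by (simp add: L2_def)
qed

lemma cmod_add_power2_le: "(cmod (z + w))\<^sup>2 \<le> 2 * (cmod z)\<^sup>2 + 2 * (cmod w)\<^sup>2"
proof -
  have "(cmod (z + w))\<^sup>2 \<le> (cmod z + cmod w)\<^sup>2"
    by (intro power_mono norm_triangle_ineq) auto
  then show ?thesis
    using sum_squares_bound[of "cmod z" "cmod w"] by (simp add: power2_sum)
qed

lemma L2_add:
  assumes "f \<in> L2" "g \<in> L2"
  shows "(\<lambda>x. f x + g x) \<in> L2"
proof (rule L2_bound)
  show "set_integrable lborel {0<..} (\<lambda>x. 2 * (cmod (f x))\<^sup>2 + 2 * (cmod (g x))\<^sup>2)"
    using L2D[OF assms(1)] L2D[OF assms(2)] by (intro set_integral_add(1)) auto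
qed (use L2D[OF assms(1)] L2D[OF assms(2)] in \<open>auto intro: set_borel_measurable_add cmod_add_power2_le\<close>)

lemma L2_cmult:
  assumes "f \<in> L2"
  shows "(\<lambda>x. r * f x) \<in> L2"
proof (rule L2_bound)
  show "set_integrable lborel {0<..} (\<lambda>x. (cmod r)\<^sup>2 * (cmod (f x))\<^sup>2)"
    using L2D[OF assms] by auto
qed (use L2D[OF assms] in \<open>auto intro: set_borel_measurable_cmult simp: norm_mult power_mult_distrib\<close>)

lemma L2_diff:
  assumes "f \<in> L2" "g \<in> L2"
  shows "(\<lambda>x. f x - g x) \<in> L2"
  using L2_add[OF assms(1) L2_cmult[OF assms(2), of "- 1"]] by simp

lemma L2_AE_cong:
  assumes "f \<in> L2" "set_borel_measurable lborel {0<..} g" "AE x in lborel. 0 < x \<longrightarrow> g x = f x"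
  shows "g \<in> L2"
proof -
  have "AE x in lborel. x \<in> {0<..} \<longrightarrow> norm ((cmod (g x))\<^sup>2) \<le> norm ((cmod (f x))\<^sup>2)"
    using assms(3) by eventually_elim auto
  then have "set_integrable lborel {0<..} (\<lambda>x. (cmod (g x))\<^sup>2)"
    by (rule set_integrable_bound[OF L2D(2)[OF assms(1)] set_borel_measurable_cmod_power2[OF assms(2)]])
  with assms(2) show ?thesis
    by (simp add: L2_def)
qed

lemma L2_mult_integrable:
  assumes "f \<in> L2" "g \<in> L2"
  shows "set_integrable lborel {0<..} (\<lambda>x. f x * cnj (g x))"
proof (rule set_integrable_bound[where f = "\<lambda>x. (cmod (f x))\<^sup>2 + (cmod (g x))\<^sup>2"])
  show "set_integrable lborel {0<..} (\<lambda>x. (cmod (f x))\<^sup>2 + (cmod (g x))\<^sup>2)"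
    using L2D[OF assms(1)] L2D[OF assms(2)] by auto
  show "set_borel_measurable lborel {0<..} (\<lambda>x. f x * cnj (g x))"
    using L2D[OF assms(1)] L2D[OF assms(2)] by (intro set_borel_measurable_mult set_borel_measurable_cnj)
  show "AE x in lborel. x \<in> {0<..} \<longrightarrow> norm (f x * cnj (g x)) \<le> norm ((cmod (f x))\<^sup>2 + (cmod (g x))\<^sup>2)"
  proof (intro AE_I2 impI)
    fix x
    show "norm (f x * cnj (g x)) \<le> norm ((cmod (f x))\<^sup>2 + (cmod (g x))\<^sup>2)"
    proof -
      have "0 \<le> cmod (f x) * cmod (g x)"
        by simp
      then have "cmod (f x) * cmod (g x) \<le> (cmod (f x))\<^sup>2 + (cmod (g x))\<^sup>2"
        using sum_squares_bound[of "cmod (f x)" "cmod (g x)"] by linarith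
      then show ?thesis
        by (simp add: norm_mult)
    qed
  qed
qed

text \<open>On a bounded interval \<open>cmod (f y)\<close> is dominated by the integrable function
  \<open>1 + (cmod (f y))^2\<close>.\<close>

lemma L2_loc_int:
  assumes "f \<in> L2"
  shows "loc_int f"
  unfolding loc_int_def
proof
  fix x :: real
  have "set_integrable lborel {0<..x} (\<lambda>y. 1 + (cmod (f y))\<^sup>2)"
  proof (rule set_integral_add(1))
    show "set_integrable lborel {0<..x} (\<lambda>y. 1 :: real)"
      unfolding set_integrable_def by (cases "0 \<le> x") auto
    show "set_integrable lborel {0<..x} (\<lambda>y. (cmod (f y))\<^sup>2)"
      by (rule set_integrable_subset[OF L2D(2)[OF assms]]) auto
  qed
  moreover have "set_borel_measurable lborel {0<..x} f"
    by (rule set_borel_measurable_subset[OF L2D(1)[OF assms]]) auto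
  moreover have "cmod (f y) \<le> norm (1 + (cmod (f y))\<^sup>2)" for y
  proof -
    have "2 * cmod (f y) \<le> (cmod (f y))\<^sup>2 + 1"
      using sum_squares_bound[of "cmod (f y)" 1] by simp
    moreover have "0 \<le> cmod (f y)" "0 \<le> (cmod (f y))\<^sup>2"
      by auto
    ultimately show ?thesis
      by (subst real_norm_def, linarith)
  qed
  ultimately show "set_integrable lborel {0<..x} f"
    by (intro set_integrable_bound[where g = f]) auto
qed

lemma continuous_loc_int:
  assumes "continuous_on {0..} f"
  shows "loc_int f"
  unfolding loc_int_def
proof
  fix x :: real
  have "set_integrable lborel {0..x} f"
    by (rule borel_integrable_atLeastAtMost') (auto intro: continuous_on_subset[OF assms])
  then show "set_integrable lborel {0<..x} f"
    by (rule set_integrable_subset) auto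
qed

lemma loc_int_diff:
  assumes "loc_int f" "loc_int g"
  shows "loc_int (\<lambda>x. f x - g x)"
  using assms by (auto simp: loc_int_def)

lemma abs_cont_loc_int:
  assumes "abs_cont f f'"
  shows "loc_int f'"
  unfolding loc_int_def
proof
  fix x :: real
  show "set_integrable lborel {0<..x} f'"
    using abs_contD(1)[OF assms, of x] by (cases "0 \<le> x") (auto simp: set_integrable_def)
qed

lemma abs_cont_indefinite:
  assumes "loc_int h"
  shows "abs_cont (\<lambda>x. r + (LINT y:{0<..x}|lborel. h y)) h"
  using assms by (auto simp: abs_cont_def loc_int_def set_lebesgue_integral_def)

section \<open>Pairing with test functions\<close>

lemma set_integral_truncate:
  fixes f :: "real \<Rightarrow> complex"
  assumes "\<And>x. R < x \<Longrightarrow> f x = 0"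
  shows "set_integrable lborel {0<..} f \<longleftrightarrow> set_integrable lborel {0<..R} f"
    and "(LINT x:{0<..}|lborel. f x) = (LINT x:{0<..R}|lborel. f x)"
proof -
  have "(\<lambda>x. indicat_real {0<..} x *\<^sub>R f x) = (\<lambda>x. indicat_real {0<..R} x *\<^sub>R f x)"
    using assms by (auto simp: indicator_def not_le)
  then show "set_integrable lborel {0<..} f \<longleftrightarrow> set_integrable lborel {0<..R} f"
    and "(LINT x:{0<..}|lborel. f x) = (LINT x:{0<..R}|lborel. f x)"
    by (simp_all add: set_integrable_def set_lebesgue_integral_def)
qed

lemma test_function_deriv:
  assumes "\<phi> \<in> test_functions"
  shows "(\<phi> has_real_derivative deriv \<phi> x) (at x)"
    and "continuous_on S \<phi>" and "continuous_on S (deriv \<phi>)"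
proof -
  have diff: "(deriv ^^ m) \<phi> differentiable at x" for m x
    using assms by (auto simp: test_functions_def)
  show "(\<phi> has_real_derivative deriv \<phi> x) (at x)"
    using diff[of 0 x] by (simp add: DERIV_deriv_iff_real_differentiable)
  show "continuous_on S \<phi>" "continuous_on S (deriv \<phi>)"
    using diff[of 0] diff[of 1]
    by (auto intro!: continuous_at_imp_continuous_on differentiable_imp_continuous_within)
qed

lemma test_function_zero: "\<phi> \<in> test_functions \<Longrightarrow> \<phi> 0 = 0"
  using closure_subset[of "{x. \<phi> x \<noteq> 0}"] by (auto simp: test_functions_def)

lemma test_function_vanishes:
  assumes "\<phi> \<in> test_functions"
  shows "\<exists>R>0. \<forall>x\<ge>R. \<phi> x = 0 \<and> deriv \<phi> x = 0"
proof -
  have "bounded (closure {x. \<phi> x \<noteq> 0})"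
    using assms by (auto simp: test_functions_def compact_imp_bounded)
  then obtain B where B: "\<And>x. x \<in> closure {x. \<phi> x \<noteq> 0} \<Longrightarrow> \<bar>x\<bar> \<le> B"
    unfolding bounded_iff by auto
  have zero: "\<phi> x = 0" if "\<bar>B\<bar> < x" for x
  proof (rule ccontr)
    assume "\<phi> x \<noteq> 0"
    then have "\<bar>x\<bar> \<le> B"
      using closure_subset[of "{x. \<phi> x \<noteq> 0}"] by (intro B) auto
    with that show False by simp
  qed
  have "deriv \<phi> x = 0" if "\<bar>B\<bar> < x" for x
  proof -
    have "((\<lambda>_. 0) has_real_derivative 0) (at x)"
      by simp
    then have "(\<phi> has_real_derivative 0) (at x)"
      by (rule DERIV_cong_ev[THEN iffD1, rotated 3])
         (use that in \<open>auto simp: zero intro!: eventually_mono[OF eventually_nhds_in_open[of "{\<bar>B\<bar><..}"]]\<close>)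
    then show ?thesis
      by (rule DERIV_imp_deriv)
  qed
  \<comment> \<open>Both vanish strictly beyond \<open>\<bar>B\<bar>\<close>, where
    \<open>\<phi>\<close> is zero on a whole neighbourhood; the margin 1 makes the bound usable with
    \<open>\<ge>\<close> and positive.\<close>
  with zero show ?thesis
    by (intro exI[of _ "\<bar>B\<bar> + 1"]) auto
qed

lemma set_integrable_continuous_scaleR:
  fixes f :: "real \<Rightarrow> complex" and g :: "real \<Rightarrow> real"
  assumes "loc_int f" "\<And>S. continuous_on S g" "\<And>x. R \<le> x \<Longrightarrow> g x = 0"
  shows "set_integrable lborel {0<..} (\<lambda>x. g x *\<^sub>R f x)"
proof (subst set_integral_truncate(1)[of R])
  have "set_integrable lborel {0<..R} (\<lambda>x. f x * complex_of_real (g x))"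
    using assms by (intro set_integrable_mult_continuous continuous_intros) (auto simp: loc_int_def)
  then show "set_integrable lborel {0<..R} (\<lambda>x. g x *\<^sub>R f x)"
    by (simp add: scaleR_conv_of_real mult.commute)
qed (use assms in auto)

lemma set_integrable_test_function:
  assumes "\<phi> \<in> test_functions" "loc_int f"
  shows "set_integrable lborel {0<..} (\<lambda>x. \<phi> x *\<^sub>R f x)"
    and "set_integrable lborel {0<..} (\<lambda>x. deriv \<phi> x *\<^sub>R f x)"
proof -
  obtain R where "\<And>x. R \<le> x \<Longrightarrow> \<phi> x = 0 \<and> deriv \<phi> x = 0"
    using test_function_vanishes[OF assms(1)] by blast
  then show "set_integrable lborel {0<..} (\<lambda>x. \<phi> x *\<^sub>R f x)"
    "set_integrable lborel {0<..} (\<lambda>x. deriv \<phi> x *\<^sub>R f x)"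
    using test_function_deriv[OF assms(1)] assms(2)
    by (auto intro!: set_integrable_continuous_scaleR[of _ _ R])
qed

text \<open>The product rule for \<open>\<phi>\<close> and \<open>f\<close> on
  \<open>{0<..R}\<close> leaves no boundary term, because \<open>\<phi>\<close> vanishes at both
  ends.\<close>

lemma abs_cont_has_weak_deriv:
  assumes "abs_cont f f'"
  shows "has_weak_deriv f f'"
  unfolding has_weak_deriv_def
proof
  fix \<phi> assume \<phi>: "\<phi> \<in> test_functions"
  obtain R where R: "0 < R" "\<And>x. R \<le> x \<Longrightarrow> \<phi> x = 0 \<and> deriv \<phi> x = 0"
    using test_function_vanishes[OF \<phi>] by blast
  have "((\<lambda>x. complex_of_real (\<phi> x)) has_vector_derivative complex_of_real (deriv \<phi> x)) (at x within {0..})" for x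
    using test_function_deriv(1)[OF \<phi>, of x]
    by (intro has_vector_derivative_of_real has_vector_derivative_at_within)
       (simp add: has_real_derivative_iff_has_vector_derivative)
  then have "abs_cont (\<lambda>x. complex_of_real (\<phi> x)) (\<lambda>x. complex_of_real (deriv \<phi> x))"
    by (rule abs_contI_C1) (intro continuous_intros test_function_deriv[OF \<phi>])
  from abs_contD(2)[OF abs_cont_mult[OF this assms], of R]
  have "(LINT x:{0<..R}|lborel. deriv \<phi> x *\<^sub>R f x + \<phi> x *\<^sub>R f' x) = 0"
    using R test_function_zero[OF \<phi>] by (simp add: scaleR_conv_of_real)
  then have "(LINT x:{0<..}|lborel. deriv \<phi> x *\<^sub>R f x + \<phi> x *\<^sub>R f' x) = 0"
    by (subst set_integral_truncate(2)[of R]) (simp_all add: R(2))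
  then show "(LINT x:{0<..}|lborel. deriv \<phi> x *\<^sub>R f x) = - (LINT x:{0<..}|lborel. \<phi> x *\<^sub>R f' x)"
    using set_integrable_test_function(1)[OF \<phi> abs_cont_loc_int[OF assms]]
      set_integrable_test_function(2)[OF \<phi> continuous_loc_int[OF abs_cont_continuous_on[OF assms]]]
    by (simp add: eq_neg_iff_add_eq_0)
qed

section \<open>From weak to classical derivatives: the fundamental lemma and the lemma of du
  Bois-Reymond\<close>

lemma bump_integral_tendsto:
  assumes "loc_int f" "0 \<le> a"
  shows "(\<lambda>m. LINT x:{0<..}|lborel. bump a b m x *\<^sub>R f x) \<longlonglongrightarrow> (LINT x:{a<..<b}|lborel. f x)"
  unfolding set_lebesgue_integral_def
proof (rule integral_dominated_convergence)
  \<comment> \<open>The bumps are at most 1 and vanish beyond \<open>b\<close>, so the cut-off of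
    \<open>f\<close> to \<open>{0<..b}\<close> dominates all integrands.\<close>
  have i: "integrable lborel (\<lambda>x. indicat_real {0<..b} x *\<^sub>R f x)"
    using assms by (simp add: loc_int_def set_integrable_def)
  then show "integrable lborel (\<lambda>x. norm (indicat_real {0<..b} x *\<^sub>R f x))"
    by (rule integrable_norm)
  have [measurable]: "(\<lambda>x. indicat_real {0<..b} x *\<^sub>R f x) \<in> borel_measurable lborel"
    using i by (rule borel_measurable_integrable)
  have [measurable]: "bump a b m \<in> borel_measurable borel" for m
    by (intro borel_measurable_continuous_onI continuous_on_smooth_alg bump_smooth_alg)
  have "(\<lambda>x. indicat_real {a<..<b} x *\<^sub>R (indicat_real {0<..b} x *\<^sub>R f x)) \<in> borel_measurable lborel"
    by measurable
  also have "(\<lambda>x. indicat_real {a<..<b} x *\<^sub>R (indicat_real {0<..b} x *\<^sub>R f x)) = (\<lambda>x. indicat_real {a<..<b} x *\<^sub>R f x)"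
    using assms by (auto simp: indicator_def)
  finally show "(\<lambda>x. indicat_real {a<..<b} x *\<^sub>R f x) \<in> borel_measurable lborel" .
  have eq: "indicat_real {0<..} x *\<^sub>R bump a b m x *\<^sub>R f x = bump a b m x *\<^sub>R (indicat_real {0<..b} x *\<^sub>R f x)" for m x
    using bump_eq_0[of x a b m] by (auto simp: indicator_def)
  show "(\<lambda>x. indicat_real {0<..} x *\<^sub>R bump a b m x *\<^sub>R f x) \<in> borel_measurable lborel" for m
    unfolding eq by measurable
  show "AE x in lborel. norm (indicat_real {0<..} x *\<^sub>R bump a b m x *\<^sub>R f x) \<le> norm (indicat_real {0<..b} x *\<^sub>R f x)" for m
    unfolding eq using bump_nonneg[of a b m] bump_le_1[of a b m]
    by (intro AE_I2) (simp add: mult_left_le_one_le mult.assoc)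
  show "AE x in lborel. (\<lambda>m. indicat_real {0<..} x *\<^sub>R bump a b m x *\<^sub>R f x) \<longlonglongrightarrow> indicat_real {a<..<b} x *\<^sub>R f x"
  proof (rule AE_I2)
    fix x
    have "(\<lambda>m. bump a b m x *\<^sub>R (indicat_real {0<..b} x *\<^sub>R f x)) \<longlonglongrightarrow> indicat_real {a<..<b} x *\<^sub>R (indicat_real {0<..b} x *\<^sub>R f x)"
      by (intro tendsto_intros bump_tendsto_indicator)
    also have "indicat_real {a<..<b} x *\<^sub>R (indicat_real {0<..b} x *\<^sub>R f x) = indicat_real {a<..<b} x *\<^sub>R f x"
      using assms by (auto simp: indicator_def)
    finally show "(\<lambda>m. indicat_real {0<..} x *\<^sub>R bump a b m x *\<^sub>R f x) \<longlonglongrightarrow> indicat_real {a<..<b} x *\<^sub>R f x"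
      unfolding eq .
  qed
qed

text \<open>Dynkin's argument: the open intervals form an intersection-stable generator of the Borel
  sets, and the sets over which \<open>f\<close> integrates to 0 are closed under complements and
  countable disjoint unions. Complements are where the total integral enters.\<close>

lemma AE_eq_0_if_interval_integrals_0:
  fixes f :: "real \<Rightarrow> complex"
  assumes f: "integrable lborel f" and "(LINT x|lborel. f x) = 0"
    and zero: "\<And>a b. (LINT x:{a<..<b}|lborel. f x) = 0"
  shows "AE x in lborel. f x = 0"
proof (rule sigma_finite_measure.density_zero[OF sigma_finite_lborel f])
  fix A :: "real set" assume "A \<in> sets lborel"
  have si: "set_integrable lborel A f" if "A \<in> sets borel" for A
    using integrable_mult_indicator[OF _ f] that by (simp add: set_integrable_def)
  let ?E = "range (\<lambda>(a, b). {a<..<b::real})"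
  have sets: "sets borel = sigma_sets UNIV ?E"
    using arg_cong[OF borel_eq_box[where 'a = real], of sets] by (simp add: box_real[abs_def])
  have "Int_stable ?E"
  proof (rule Int_stableI)
    fix X Y assume "X \<in> ?E" "Y \<in> ?E"
    then obtain a b c d where "X = {a<..<b}" "Y = {c<..<d}"
      by auto
    then have "X \<inter> Y = (case (max a c, min b d) of (a, b) \<Rightarrow> {a<..<b})"
      by auto
    then show "X \<inter> Y \<in> ?E"
      by blast
  qed
  moreover have "?E \<subseteq> Pow UNIV"
    by simp
  moreover have "A \<in> sigma_sets UNIV ?E"
    using \<open>A \<in> sets lborel\<close> by (simp add: sets)
  ultimately show "(LINT x:A|lborel. f x) = 0"
  proof (induction rule: sigma_sets_induct_disjoint)
    case (basic A)
    then show ?case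
      using zero by auto
  next
    case empty
    then show ?case
      by (simp add: set_lebesgue_integral_def)
  next
    case (compl A)
    then have "A \<in> sets borel"
      by (simp add: sets)
    then have "(LINT x:A \<union> (UNIV - A)|lborel. f x) = (LINT x:A|lborel. f x) + (LINT x:UNIV - A|lborel. f x)"
      by (intro set_integral_Un si) auto
    with compl assms(2) show ?case
      by (simp add: set_lebesgue_integral_def)
  next
    case (union B)
    have m: "B i \<in> sets borel" for i
      using union(2) by (auto simp: sets)
    have "(LINT x:\<Union> (range B)|lborel. f x) = (\<Sum>i. LINT x:B i|lborel. f x)"
      by (rule lebesgue_integral_countable_add)
         (use m union(1) in \<open>auto simp: disjoint_family_on_def intro!: si\<close>)
    with union show ?case
      by simp
  qed
qed

lemma fundamental_lemma:
  assumes f: "loc_int f" and zero: "\<And>\<phi>. \<phi> \<in> test_functions \<Longrightarrow> (LINT x:{0<..}|lborel. \<phi> x *\<^sub>R f x) = 0"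
  shows "AE x in lborel. 0 < x \<longrightarrow> f x = 0"
proof -
  have int: "(LINT x:{a<..<b}|lborel. f x) = 0" if "0 < a" for a b
  proof -
    have "(\<lambda>m. LINT x:{0<..}|lborel. bump a b m x *\<^sub>R f x) \<longlonglongrightarrow> (LINT x:{a<..<b}|lborel. f x)"
      using that by (intro bump_integral_tendsto f) auto
    moreover have "(LINT x:{0<..}|lborel. bump a b m x *\<^sub>R f x) = 0" for m
      using that by (intro zero bump_test)
    ultimately show ?thesis
      by (simp add: LIMSEQ_const_iff)
  qed
  \<comment> \<open>Test functions only reach intervals away from 0, and \<open>f\<close> need not
    be integrable over the whole half-line. On each of these bounded intervals both difficulties
    disappear, and countably many null sets may be collected.\<close>
  have "AE x in lborel. \<forall>N. indicat_real {1 / real (Suc N)<..<real (Suc N)} x *\<^sub>R f x = 0"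
  proof (subst AE_all_countable, rule allI, rule AE_eq_0_if_interval_integrals_0)
    fix N
    define l r where "l = 1 / real (Suc N)" and "r = real (Suc N)"
    have "0 < l" by (simp add: l_def)
    have "set_integrable lborel {l<..<r} f"
      by (rule set_integrable_subset[of _ "{0<..r}"]) (use f \<open>0 < l\<close> in \<open>auto simp: loc_int_def\<close>)
    then show "integrable lborel (\<lambda>x. indicat_real {l<..<r} x *\<^sub>R f x)"
      by (simp add: set_integrable_def)
    show "(LINT x|lborel. indicat_real {l<..<r} x *\<^sub>R f x) = 0"
      using int[OF \<open>0 < l\<close>] by (simp add: set_lebesgue_integral_def)
    have "(LINT x:{a<..<b}|lborel. indicat_real {l<..<r} x *\<^sub>R f x) = (LINT x:{max a l<..<min b r}|lborel. f x)" for a b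
      unfolding set_lebesgue_integral_def
      by (rule Bochner_Integration.integral_cong) (auto simp: indicator_def)
    then show "(LINT x:{a<..<b}|lborel. indicat_real {l<..<r} x *\<^sub>R f x) = 0" for a b
      using int[of "max a l"] \<open>0 < l\<close> by simp
  qed
  then show ?thesis
  proof eventually_elim
    case (elim x)
    show ?case
    proof
      assume "0 < x"
      obtain N where "max x (1 / x) < real N"
        using reals_Archimedean2 by blast
      with \<open>0 < x\<close> have "1 / real (Suc N) < x" "x < real (Suc N)"
        by (auto simp: field_simps)
      then show "f x = 0"
        using elim[rule_format, of N] by (auto simp: indicator_def)
    qed
  qed
qed

lemma has_weak_deriv_unique:
  assumes "has_weak_deriv u v" "has_weak_deriv u v'" "loc_int v" "loc_int v'"
  shows "AE x in lborel. 0 < x \<longrightarrow> v x = v' x"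
proof -
  have "AE x in lborel. 0 < x \<longrightarrow> v x - v' x = 0"
  proof (rule fundamental_lemma)
    show "loc_int (\<lambda>x. v x - v' x)"
      using assms by (intro loc_int_diff)
    fix \<phi> assume \<phi>: "\<phi> \<in> test_functions"
    then have "(LINT x:{0<..}|lborel. \<phi> x *\<^sub>R v x) = (LINT x:{0<..}|lborel. \<phi> x *\<^sub>R v' x)"
      using assms(1,2) by (simp add: has_weak_deriv_def)
    then show "(LINT x:{0<..}|lborel. \<phi> x *\<^sub>R (v x - v' x)) = 0"
      using set_integrable_test_function(1)[OF \<phi> assms(3)]
        set_integrable_test_function(1)[OF \<phi> assms(4)]
      by (simp add: scaleR_diff_right)
  qed
  then show ?thesis by simp
qed

text \<open>Testing with antiderivatives of a bump minus its translate, and letting the bumps tend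
  to indicators, shows that the integral of \<open>r\<close> over an interval is unchanged when the
  interval is shifted. For a primitive \<open>G\<close> of \<open>r\<close> this means that
  \<open>G x - G (x + d)\<close> is constant in \<open>x\<close>; differentiation gives
  \<open>r y = r (y + d)\<close>.\<close>

lemma du_Bois_Reymond:
  assumes r: "continuous_on {0..} r" and zero: "has_weak_deriv r (\<lambda>_. 0)" and x: "0 \<le> x"
  shows "r x = r 0"
proof -
  define G where "G x = integral {0..x} r" for x
  have loc: "loc_int r"
    by (rule continuous_loc_int[OF r])
  have int: "r integrable_on {a..b}" if "0 \<le> a" for a b
    using that by (intro integrable_continuous_real continuous_on_subset[OF r]) auto
  have G: "(LINT x:{a<..<b}|lborel. r x) = G b - G a" if "0 < a" "a < b" for a b
  proof -
    have "set_integrable lborel {a<..<b} r"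
      by (rule set_integrable_subset[of _ "{0<..b}"]) (use loc that in \<open>auto simp: loc_int_def\<close>)
    then have "(LINT x:{a<..<b}|lborel. r x) = integral {a..b} r"
      using set_borel_integral_eq_integral(2) integral_open_interval_real by metis
    moreover have "G a + integral {a..b} r = G b"
      unfolding G_def using that by (intro Henstock_Kurzweil_Integration.integral_combine int) auto
    ultimately show ?thesis by (simp add: algebra_simps)
  qed
  have shift: "G b - G a = G (b + d) - G (a + d)" if abd: "0 < a" "a < b" "0 \<le> d" for a b d
  proof -
    have "(LINT x:{0<..}|lborel. bump a b m x *\<^sub>R r x) = (LINT x:{0<..}|lborel. bump (a + d) (b + d) m x *\<^sub>R r x)" for m
    proof -
      obtain \<phi> where \<phi>: "\<phi> \<in> test_functions" "\<And>x. deriv \<phi> x = bump a b m x - bump (a + d) (b + d) m x"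
        using bump_difference_antiderivative[OF abd, of m] by blast
      have "(LINT x:{0<..}|lborel. (bump a b m x - bump (a + d) (b + d) m x) *\<^sub>R r x) = 0"
        using zero[unfolded has_weak_deriv_def, rule_format, OF \<phi>(1)] by (simp add: \<phi>(2))
      moreover have "set_integrable lborel {0<..} (\<lambda>x. bump a b m x *\<^sub>R r x)"
        "set_integrable lborel {0<..} (\<lambda>x. bump (a + d) (b + d) m x *\<^sub>R r x)"
        using set_integrable_test_function(1)[OF bump_test loc] that by auto
      ultimately show ?thesis
        by (simp add: scaleR_diff_left)
    qed
    then have "(LINT x:{a<..<b}|lborel. r x) = (LINT x:{a+d<..<b+d}|lborel. r x)"
      using bump_integral_tendsto[OF loc, of a b] bump_integral_tendsto[OF loc, of "a + d" "b + d"] that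
      by (intro LIMSEQ_unique[of "\<lambda>m. LINT x:{0<..}|lborel. bump a b m x *\<^sub>R r x"]) auto
    then show ?thesis
      using that by (simp add: G)
  qed
  have deriv: "(G has_vector_derivative r x) (at x)" if "0 < x" for x
  proof -
    have "(G has_vector_derivative r x) (at x within {0..x+1})"
      unfolding G_def using that
      by (intro integral_has_vector_derivative continuous_on_subset[OF r]) auto
    moreover have "at x within {0..x+1} = at x"
      by (rule at_within_interior) (use that in auto)
    ultimately show ?thesis by simp
  qed
  have eq: "r y = r (y + d)" if "0 < y" "0 \<le> d" for y d
  proof -
    have "(\<lambda>x. G (x + d)) = G \<circ> (\<lambda>x. x + d)"
      by auto
    moreover have "((\<lambda>x::real. x + d) has_vector_derivative 1) (at y)"
      by (auto intro!: derivative_eq_intros)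
    ultimately have "((\<lambda>x. G (x + d)) has_vector_derivative r (y + d)) (at y)"
      using vector_diff_chain_at[of "\<lambda>x. x + d" 1 y G "r (y + d)"] deriv[of "y + d"] that by simp
    then have "((\<lambda>x. G x - G (x + d)) has_vector_derivative (r y - r (y + d))) (at y)"
      using that by (intro has_vector_derivative_diff deriv)
    moreover have "((\<lambda>x. G x - G (x + d)) has_vector_derivative 0) (at y)"
    proof (rule has_vector_derivative_transform_within_open[of "\<lambda>_. G y - G (y + d)" _ _ "{0<..}"])
      show "G y - G (y + d) = G x - G (x + d)" if "x \<in> {0<..}" for x
        using shift[of x y d] shift[of y x d] that \<open>0 < y\<close> \<open>0 \<le> d\<close>
        by (cases x y rule: linorder_cases) (auto simp: algebra_simps)
    qed (use that in auto)
    ultimately show ?thesis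
      using vector_derivative_unique_at by fastforce
  qed
  have const: "r y = r 1" if "y \<in> {0<..}" for y
  proof (cases "y \<le> 1")
    case True
    with that have "r y = r (y + (1 - y))"
      by (intro eq) auto
    moreover have "y + (1 - y) = 1"
      by simp
    ultimately show ?thesis
      by (simp only:)
  next
    case False
    then have "r 1 = r (1 + (y - 1))"
      by (intro eq) auto
    then show ?thesis
      by simp
  qed
  \<comment> \<open>The shifts compare points of the open half-line only; continuity carries the
    constant to the vertex.\<close>
  have cl: "closure {0<..} = {0::real..}"
    by simp
  show ?thesis
  proof -
    have "r y = r 1" if "0 \<le> y" for y
      by (rule continuous_constant_on_closure[of "{0<..}" r "r 1" y]) (use r const that in \<open>simp_all only: cl atLeast_iff\<close>)
    from this[OF x] this[of 0] show ?thesis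
      by simp
  qed
qed

text \<open>The indefinite integral of \<open>h\<close> also has weak derivative \<open>h\<close>,
  so its difference from \<open>f\<close> has weak derivative 0 and is constant.\<close>

lemma has_weak_deriv_abs_cont:
  assumes f: "continuous_on {0..} f" and h: "loc_int h" and w: "has_weak_deriv f h"
  shows "abs_cont f h"
proof -
  define H where "H x = 0 + (LINT y:{0<..x}|lborel. h y)" for x
  have H: "abs_cont H h"
    unfolding H_def by (rule abs_cont_indefinite[OF h])
  have cH: "continuous_on {0..} H"
    by (rule abs_cont_continuous_on[OF H])
  have "has_weak_deriv (\<lambda>x. f x - H x) (\<lambda>_. 0)"
    unfolding has_weak_deriv_def
  proof
    fix \<phi> assume \<phi>: "\<phi> \<in> test_functions"
    have "(LINT x:{0<..}|lborel. deriv \<phi> x *\<^sub>R f x) = (LINT x:{0<..}|lborel. deriv \<phi> x *\<^sub>R H x)"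
      using abs_cont_has_weak_deriv[OF H] w \<phi> by (simp add: has_weak_deriv_def)
    then show "(LINT x:{0<..}|lborel. deriv \<phi> x *\<^sub>R (f x - H x)) = - (LINT x:{0<..}|lborel. \<phi> x *\<^sub>R 0)"
      using set_integrable_test_function(2)[OF \<phi> continuous_loc_int[OF f]]
        set_integrable_test_function(2)[OF \<phi> continuous_loc_int[OF cH]]
      by (simp add: scaleR_diff_right)
  qed
  then have eq: "f x - H x = f 0 - H 0" if "0 \<le> x" for x
    using du_Bois_Reymond[of "\<lambda>x. f x - H x" x] f cH that by (auto intro!: continuous_intros)
  have H0: "H 0 = 0"
    by (simp add: H_def set_lebesgue_integral_def)
  have "f x = f 0 + (LINT y:{0<..x}|lborel. h y)" if "0 \<le> x" for x
    using eq[OF that] unfolding H0 by (simp add: H_def algebra_simps)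
  then show ?thesis
    unfolding abs_cont_def using h unfolding loc_int_def by blast
qed

subsection \<open>The energy identity\<close>

lemma D_half_eq:
  assumes "(f has_vector_derivative f') (at x within {0..})" "0 \<le> x"
  shows "D_half f x = f'"
proof -
  have "at x within {0..} \<noteq> bot"
    unfolding at_within_half_line[OF assms(2)] using assms(2) by (simp add: trivial_limit_within islimpt_Icc)
  then show ?thesis
    unfolding D_half_def by (rule vector_derivative_within) (rule assms(1))
qed

lemma has_vector_derivative_D_half:
  assumes "f differentiable_on {0..}" "0 \<le> x"
  shows "(f has_vector_derivative D_half f x) (at x within {0..})"
  using assms by (auto simp: differentiable_on_def D_half_def vector_derivative_works[symmetric])

lemma abs_cont_D_half:
  assumes "f \<in> C_halfline 1"
  shows "abs_cont f (D_half f)"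
  using assms by (intro abs_contI_C1 has_vector_derivative_D_half) auto

lemma C_halfline_1I:
  assumes "abs_cont f f'" "continuous_on {0..} f'"
  shows "f \<in> C_halfline 1" and "0 \<le> x \<Longrightarrow> D_half f x = f' x"
proof -
  note d = abs_cont_has_derivative[OF assms]
  show D: "D_half f x = f' x" if "0 \<le> x" for x
    by (rule D_half_eq[OF d[OF that] that])
  have "f differentiable_on {0..}"
    using d unfolding differentiable_on_def by (auto intro: differentiableI_vector)
  moreover have "continuous_on {0..} (D_half f)"
    by (rule continuous_on_eq[OF assms(2)]) (simp add: D)
  ultimately show "f \<in> C_halfline 1"
    by simp
qed

text \<open>\<open>weak_deriv\<close> is an arbitrary choice: one square-integrable weak derivative
  makes the choice meaningful, and the fundamental lemma determines it almost everywhere.\<close>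

lemma weak_deriv_props:
  assumes "v \<in> L2" "has_weak_deriv u v"
  shows "weak_deriv u \<in> L2" "has_weak_deriv u (weak_deriv u)"
    and "AE x in lborel. 0 < x \<longrightarrow> weak_deriv u x = v x"
proof -
  have "weak_deriv u \<in> L2 \<and> has_weak_deriv u (weak_deriv u)"
    unfolding weak_deriv_def using assms by (intro someI[of "\<lambda>v. v \<in> L2 \<and> has_weak_deriv u v"]) auto
  then show L2: "weak_deriv u \<in> L2" "has_weak_deriv u (weak_deriv u)"
    by auto
  show "AE x in lborel. 0 < x \<longrightarrow> weak_deriv u x = v x"
    by (rule has_weak_deriv_unique[OF L2(2) assms(2)]) (intro L2_loc_int L2 assms)+
qed

lemma has_weak_deriv_AE_cong:
  assumes v: "has_weak_deriv v w" and ae: "AE x in lborel. 0 < x \<longrightarrow> v' x = v x"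
    and "loc_int v" "loc_int v'"
  shows "has_weak_deriv v' w"
  unfolding has_weak_deriv_def
proof
  fix \<phi> assume \<phi>: "\<phi> \<in> test_functions"
  have m: "set_borel_measurable lborel {0<..} (\<lambda>x. deriv \<phi> x *\<^sub>R f x)" if "loc_int f" for f
    using set_integrable_test_function(2)[OF \<phi> that]
    unfolding set_integrable_def set_borel_measurable_def by (rule borel_measurable_integrable)
  have "AE x in lborel. x \<in> {0<..} \<longrightarrow> deriv \<phi> x *\<^sub>R v' x = deriv \<phi> x *\<^sub>R v x"
    using ae by eventually_elim auto
  then have "(LINT x:{0<..}|lborel. deriv \<phi> x *\<^sub>R v' x) = (LINT x:{0<..}|lborel. deriv \<phi> x *\<^sub>R v x)"
    by (rule set_borel_measurable_AE_cong(2)[OF m[OF assms(4)] m[OF assms(3)]])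
  with v \<phi> show "(LINT x:{0<..}|lborel. deriv \<phi> x *\<^sub>R v' x) = - (LINT x:{0<..}|lborel. \<phi> x *\<^sub>R w x)"
    by (simp add: has_weak_deriv_def)
qed

text \<open>The second choice in \<open>weak_deriv (weak_deriv u)\<close> is made for the
  representative produced by the first, not for \<open>v\<close>. Hence the transport along equality
  almost everywhere, once in each direction.\<close>

lemma weak_deriv2_props:
  assumes "v \<in> L2" "has_weak_deriv u v" "w \<in> L2" "has_weak_deriv v w"
  shows "weak_deriv (weak_deriv u) \<in> L2" "has_weak_deriv v (weak_deriv (weak_deriv u))"
    and "AE x in lborel. 0 < x \<longrightarrow> weak_deriv (weak_deriv u) x = w x"
proof -
  note u = weak_deriv_props[OF assms(1,2)]
  have ae: "AE x in lborel. 0 < x \<longrightarrow> v x = weak_deriv u x"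
    using u(3) by eventually_elim auto
  have "has_weak_deriv (weak_deriv u) w"
    by (rule has_weak_deriv_AE_cong[OF assms(4) u(3)]) (intro L2_loc_int u assms)+
  note u2 = weak_deriv_props[OF assms(3) this]
  show "weak_deriv (weak_deriv u) \<in> L2"
    and "AE x in lborel. 0 < x \<longrightarrow> weak_deriv (weak_deriv u) x = w x"
    by (fact u2)+
  show "has_weak_deriv v (weak_deriv (weak_deriv u))"
    by (rule has_weak_deriv_AE_cong[OF u2(2) ae]) (intro L2_loc_int u assms)+
qed

text \<open>The classical derivative agrees almost everywhere with the weak one; being continuous,
  it is then an indefinite integral of the weak second derivative. This ties the derivative at the
  vertex, which occurs in \<open>T1\<close>, to integrals over the branch.\<close>

lemma H2_regularity:
  assumes "u \<in> H2" "u \<in> C_halfline 1"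
  shows "D_half u \<in> L2" "weak_deriv (weak_deriv u) \<in> L2"
    and "abs_cont (D_half u) (weak_deriv (weak_deriv u))"
proof -
  obtain v w where vw: "v \<in> L2" "has_weak_deriv u v" "w \<in> L2" "has_weak_deriv v w"
    using assms(1) by (auto simp: H2_def)
  note W = weak_deriv2_props[OF vw]
  have cont: "continuous_on {0..} (D_half u)"
    using assms(2) by simp
  have loc: "loc_int (D_half u)" "loc_int v"
    by (intro continuous_loc_int cont L2_loc_int vw)+
  have ae: "AE x in lborel. 0 < x \<longrightarrow> D_half u x = v x"
    by (rule has_weak_deriv_unique[OF abs_cont_has_weak_deriv[OF abs_cont_D_half[OF assms(2)]] vw(2) loc])
  show "D_half u \<in> L2"
    by (rule L2_AE_cong[OF vw(1) set_borel_measurable_half_line[OF cont] ae])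
  show "weak_deriv (weak_deriv u) \<in> L2"
    by (fact W)
  have "has_weak_deriv (D_half u) (weak_deriv (weak_deriv u))"
    by (rule has_weak_deriv_AE_cong[OF W(2) ae loc(2,1)])
  then show "abs_cont (D_half u) (weak_deriv (weak_deriv u))"
    by (rule has_weak_deriv_abs_cont[OF cont L2_loc_int[OF W(1)]])
qed

lemma H2I:
  assumes "u \<in> L2" "d \<in> L2" "h \<in> L2" "abs_cont u d" "abs_cont d h"
  shows "u \<in> H2" "AE x in lborel. 0 < x \<longrightarrow> weak_deriv (weak_deriv u) x = h x"
proof -
  have "has_weak_deriv u d" "has_weak_deriv d h"
    using assms by (auto intro: abs_cont_has_weak_deriv)
  with assms show "u \<in> H2" "AE x in lborel. 0 < x \<longrightarrow> weak_deriv (weak_deriv u) x = h x"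
    using weak_deriv2_props(3) unfolding H2_def by blast+
qed

section \<open>Integration by parts up to infinity\<close>

lemma integrable_limit_0:
  fixes F :: "real \<Rightarrow> complex"
  assumes F: "set_integrable lborel {0<..} F" and lim: "(F \<longlongrightarrow> L) at_top"
  shows "L = 0"
proof (rule ccontr)
  assume "L \<noteq> 0"
  define \<delta> where "\<delta> = cmod L / 2"
  have "\<delta> > 0" "\<delta> < cmod L"
    using \<open>L \<noteq> 0\<close> by (auto simp: \<delta>_def)
  have "eventually (\<lambda>x. \<delta> < cmod (F x)) at_top"
    by (rule order_tendstoD(1)[OF tendsto_norm[OF lim] \<open>\<delta> < cmod L\<close>])
  then obtain N where N: "\<And>x. N \<le> x \<Longrightarrow> \<delta> < cmod (F x)"
    by (auto simp: eventually_at_top_linorder)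
  define M where "M = max N 0"
  define I where "I = (LINT x:{0<..}|lborel. cmod (F x))"
  have nF: "set_integrable lborel {0<..} (\<lambda>x. cmod (F x))"
    using F unfolding set_integrable_def by (drule_tac integrable_norm) (simp add: norm_scaleR)
  \<comment> \<open>Over a window of this length, placed where \<open>cmod (F x)\<close> exceeds
    \<open>\<delta>\<close>, the integral is already larger than \<open>I\<close>.\<close>
  obtain n :: nat where n: "I / \<delta> < real n"
    using reals_Archimedean2 by blast
  have "(LINT x:{M<..M + real n}|lborel. \<delta>) \<le> (LINT x:{M<..M + real n}|lborel. cmod (F x))"
  proof (rule set_integral_mono)
    show "set_integrable lborel {M<..M + real n} (\<lambda>x. \<delta>)"
      unfolding set_integrable_def by simp
    show "set_integrable lborel {M<..M + real n} (\<lambda>x. cmod (F x))"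
      by (rule set_integrable_subset[OF nF]) (auto simp: M_def)
    show "\<delta> \<le> cmod (F x)" if "x \<in> {M<..M + real n}" for x
      using N[of x] that by (auto simp: M_def)
  qed
  also have "\<dots> \<le> I"
    unfolding I_def set_lebesgue_integral_def
  proof (rule integral_mono)
    show "integrable lborel (\<lambda>x. indicat_real {M<..M + real n} x *\<^sub>R cmod (F x))"
      unfolding set_integrable_def[symmetric]
      by (rule set_integrable_subset[OF nF]) (auto simp: M_def)
    show "integrable lborel (\<lambda>x. indicat_real {0<..} x *\<^sub>R cmod (F x))"
      using nF by (simp add: set_integrable_def)
  qed (auto simp: M_def indicator_def)
  finally have "real n * \<delta> \<le> I"
    by (simp add: set_lebesgue_integral_def)
  with n \<open>\<delta> > 0\<close> show False
    by (simp add: field_simps)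
qed

lemma abs_cont_tendsto:
  assumes F: "abs_cont F g" and g: "set_integrable lborel {0<..} g"
  shows "(F \<longlongrightarrow> F 0 + (LINT x:{0<..}|lborel. g x)) at_top"
proof -
  have "(\<lambda>x. indicat_real {0..} x *\<^sub>R (indicat_real {0<..} x *\<^sub>R g x)) = (\<lambda>x. indicat_real {0<..} x *\<^sub>R g x)"
    by (auto simp: indicator_def)
  then have "set_integrable lborel {0..} (\<lambda>x. indicat_real {0<..} x *\<^sub>R g x)"
    and *: "(LINT x:{0..}|lborel. indicat_real {0<..} x *\<^sub>R g x) = (LINT x:{0<..}|lborel. g x)"
    using g by (simp_all add: set_integrable_def set_lebesgue_integral_def)
  then have "((\<lambda>b. LINT x:{0..b}|lborel. indicat_real {0<..} x *\<^sub>R g x) \<longlongrightarrow> (LINT x:{0<..}|lborel. g x)) at_top"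
    unfolding *[symmetric] by (intro tendsto_set_lebesgue_integral_at_top) auto
  moreover have "(LINT x:{0..b}|lborel. indicat_real {0<..} x *\<^sub>R g x) = (LINT x:{0<..b}|lborel. g x)" for b
    unfolding set_lebesgue_integral_def by (rule Bochner_Integration.integral_cong) (auto simp: indicator_def)
  ultimately have "((\<lambda>b. LINT x:{0<..b}|lborel. g x) \<longlongrightarrow> (LINT x:{0<..}|lborel. g x)) at_top"
    by simp
  then have "((\<lambda>b. F 0 + (LINT x:{0<..b}|lborel. g x)) \<longlongrightarrow> F 0 + (LINT x:{0<..}|lborel. g x)) at_top"
    by (intro tendsto_intros)
  then show ?thesis
    by (rule Lim_transform_eventually)
       (auto intro!: eventually_mono[OF eventually_ge_at_top[of 0]] abs_contD(2)[OF F, symmetric])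
qed

text \<open>\<open>F\<close> has a limit at infinity because its density is integrable, and the
  limit is 0 because \<open>F\<close> itself is integrable. Boundary terms at infinity thus vanish
  without decay statements for the individual factors.\<close>

lemma abs_cont_integral_half_line:
  assumes "abs_cont F g" "set_integrable lborel {0<..} g" "set_integrable lborel {0<..} F"
  shows "(LINT x:{0<..}|lborel. g x) = - F 0"
  using integrable_limit_0[OF assms(3) abs_cont_tendsto[OF assms(1,2)]]
  by (simp add: add_eq_0_iff)

lemma set_integral_Re:
  assumes "set_integrable M A f"
  shows "set_integrable M A (\<lambda>x. Re (f x))" "(LINT x:A|M. Re (f x)) = Re (LINT x:A|M. f x)"
  using integrable_Re[OF assms[unfolded set_integrable_def]] integral_Re[OF assms[unfolded set_integrable_def]]
  by (simp_all add: set_integrable_def set_lebesgue_integral_def)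

text \<open>With \<open>f = c h - b u\<close>, the square of \<open>f + u\<close> bounds
  \<open>- 2 Re (f cnj u)\<close> by \<open>|f|^2 + |u|^2\<close>, while up to a total derivative
  the same quantity is at least \<open>2 b |u|^2\<close>. Since \<open>b \<ge> 1\<close>, one
  \<open>|u|^2\<close> is left over. The boundary term is kept because it cancels only in the sum
  over the branches.\<close>

lemma branch_energy_estimate:
  fixes c b :: real and u d h :: "real \<Rightarrow> complex"
  assumes "u \<in> L2" "d \<in> L2" "h \<in> L2" "abs_cont u d" "abs_cont d h" and "0 < c" "1 \<le> b"
  shows "(LINT x:{0<..}|lborel. (cmod (u x))\<^sup>2) \<le>
           (LINT x:{0<..}|lborel. (cmod (complex_of_real c * h x - complex_of_real b * u x))\<^sup>2) - 2 * Re (complex_of_real c * d 0 * cnj (u 0))"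
proof -
  define f where "f x = complex_of_real c * h x - complex_of_real b * u x" for x
  have f: "f \<in> L2"
    unfolding f_def by (intro L2_diff L2_cmult assms)
  define e where "e x = h x * cnj (u x) + d x * cnj (d x)" for x
  have "abs_cont (\<lambda>x. d x * cnj (u x)) e"
    unfolding e_def by (intro abs_cont_mult abs_cont_cnj assms)
  moreover have e: "set_integrable lborel {0<..} e"
    unfolding e_def by (intro set_integral_add(1) L2_mult_integrable assms)
  ultimately have int_e: "(LINT x:{0<..}|lborel. e x) = - (d 0 * cnj (u 0))"
    by (intro abs_cont_integral_half_line L2_mult_integrable assms)
  have pointwise: "(cmod (u x))\<^sup>2 \<le> 2 * c * Re (e x) + (cmod (f x))\<^sup>2" for x
  proof -
    have "cmod (f x + u x)^2 = (cmod (f x))\<^sup>2 + (cmod (u x))\<^sup>2 + 2 * Re (f x * cnj (u x))"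
      by (simp only: cmod_power2) (simp add: power2_eq_square algebra_simps)
    then have "- 2 * Re (f x * cnj (u x)) \<le> (cmod (f x))\<^sup>2 + (cmod (u x))\<^sup>2"
      using zero_le_power2[of "cmod (f x + u x)"] by linarith
    moreover have "Re (f x * cnj (u x)) = c * Re (e x) - c * (cmod (d x))\<^sup>2 - b * (cmod (u x))\<^sup>2"
      unfolding f_def e_def by (simp only: cmod_power2) (simp add: power2_eq_square algebra_simps)
    moreover have "0 \<le> c * (cmod (d x))\<^sup>2" "(cmod (u x))\<^sup>2 \<le> b * (cmod (u x))\<^sup>2"
      using assms by (auto intro: mult_right_mono[of 1 b, simplified])
    ultimately show ?thesis
      by linarith
  qed
  have "(LINT x:{0<..}|lborel. (cmod (u x))\<^sup>2) \<le> (LINT x:{0<..}|lborel. 2 * c * Re (e x) + (cmod (f x))\<^sup>2)"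
    using L2D(2)[OF assms(1)] L2D(2)[OF f] set_integral_Re(1)[OF e] pointwise
    by (intro set_integral_mono) auto
  also have "\<dots> = 2 * c * Re (LINT x:{0<..}|lborel. e x) + (LINT x:{0<..}|lborel. (cmod (f x))\<^sup>2)"
    using L2D(2)[OF f] set_integral_Re[OF e] by simp
  finally show ?thesis
    unfolding int_e by (simp add: f_def algebra_simps)
qed

subsection \<open>Square-integrable solutions on a branch\<close>

lemma abs_cont_exp:
  "abs_cont (\<lambda>x. complex_of_real (exp (\<mu> * x))) (\<lambda>x. complex_of_real \<mu> * complex_of_real (exp (\<mu> * x)))"
proof (rule abs_contI_C1)
  fix x :: real
  have "((\<lambda>x. exp (\<mu> * x)) has_real_derivative \<mu> * exp (\<mu> * x)) (at x within {0..})"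
    by (auto intro!: derivative_eq_intros)
  then show "((\<lambda>x. complex_of_real (exp (\<mu> * x))) has_vector_derivative
      complex_of_real \<mu> * complex_of_real (exp (\<mu> * x))) (at x within {0..})"
    using has_vector_derivative_of_real by fastforce
qed (intro continuous_intros)

text \<open>Variation of constants, with \<open>r\<close> the value at 0. For positive
  \<open>\<mu>\<close> the choice of \<open>r\<close> decides between growth and
  square-integrability.\<close>

lemma first_order_solution:
  fixes \<mu> :: real
  assumes "loc_int g"
  defines "h \<equiv> \<lambda>x. complex_of_real (exp (- \<mu> * x)) * g x"
  shows "abs_cont (\<lambda>x. complex_of_real (exp (\<mu> * x)) * (r + (LINT t:{0<..x}|lborel. h t)))
           (\<lambda>x. complex_of_real \<mu> * (complex_of_real (exp (\<mu> * x)) * (r + (LINT t:{0<..x}|lborel. h t))) + g x)"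
proof -
  have "loc_int h"
    unfolding loc_int_def
  proof
    fix x
    have "set_integrable lborel {0<..x} (\<lambda>t. g t * complex_of_real (exp (- \<mu> * t)))"
      using assms by (intro set_integrable_mult_continuous continuous_intros) (simp add: loc_int_def)
    then show "set_integrable lborel {0<..x} h"
      by (simp add: h_def mult.commute)
  qed
  from abs_cont_mult[OF abs_cont_exp[of \<mu>] abs_cont_indefinite[OF this, of r]]
  show ?thesis
    by (simp add: h_def mult.assoc[symmetric] of_real_mult[symmetric] exp_add[symmetric] del: of_real_mult)
qed

lemma L2_if_integrals_bounded:
  assumes y: "continuous_on {0..} y"
    and bound: "\<And>T. 0 \<le> T \<Longrightarrow> (LINT x:{0<..T}|lborel. (cmod (y x))\<^sup>2) \<le> C"
  shows "y \<in> L2"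
proof -
  have int: "set_integrable lborel {0<..T} (\<lambda>x. (cmod (y x))\<^sup>2)" for T
  proof (rule set_integrable_subset)
    show "set_integrable lborel {0..T} (\<lambda>x. (cmod (y x))\<^sup>2)"
      by (rule borel_integrable_atLeastAtMost') (auto intro!: continuous_intros continuous_on_subset[OF y])
  qed auto
  define J where "J i = (LINT x:{0<..real i}|lborel. (cmod (y x))\<^sup>2)" for i
  have "incseq J"
    unfolding J_def set_lebesgue_integral_def
    using int[unfolded set_integrable_def]
    by (intro monoI integral_mono) (auto simp: indicator_def)
  moreover have "J i \<le> C" for i
    unfolding J_def by (rule bound) simp
  ultimately obtain l where "J \<longlonglongrightarrow> l"
    using incseq_convergent by metis
  then have "set_integrable lborel (\<Union>i. {0<..real i}) (\<lambda>x. (cmod (y x))\<^sup>2)"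
    unfolding J_def by (intro pos_integrable_to_top[where l = l] int) (auto simp: mono_def)
  also have "(\<Union>i. {0<..real i}) = {0<..}"
    using real_arch_simple by (auto simp: set_eq_iff)
  finally show ?thesis
    using set_borel_measurable_half_line[OF y] by (simp add: L2_def)
qed

text \<open>With \<open>\<kappa> = \<bar>\<mu>\<bar>\<close> and \<open>\<sigma> = sgn \<mu>\<close>, completing the square in \<open>\<bar>\<kappa> y + \<sigma> g\<bar>\<^sup>2 \<ge> 0\<close> bounds
  \<open>\<kappa> \<bar>y\<bar>\<^sup>2\<close> by \<open>\<sigma> (\<bar>y\<bar>\<^sup>2)' + \<bar>g\<bar>\<^sup>2 / \<kappa>\<close>.\<close>

lemma L2_first_order:
  fixes \<mu> :: real
  assumes \<mu>: "\<mu> \<noteq> 0" and y: "abs_cont y (\<lambda>x. complex_of_real \<mu> * y x + g x)" and g: "g \<in> L2"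
    and growth: "\<mu> < 0 \<or> (\<exists>C. \<forall>x\<ge>0. cmod (y x) \<le> C)"
  shows "y \<in> L2"
proof -
  define \<kappa> where "\<kappa> = \<bar>\<mu>\<bar>"
  define \<sigma> where "\<sigma> = sgn \<mu>"
  have \<kappa>: "\<kappa> > 0" and \<sigma>: "\<sigma> = 1 \<or> \<sigma> = - 1" and \<mu>_eq: "\<mu> = \<sigma> * \<kappa>"
    using \<mu> by (auto simp: \<kappa>_def \<sigma>_def sgn_real_def)
  define e where "e x = (complex_of_real \<mu> * y x + g x) * cnj (y x) + y x * cnj (complex_of_real \<mu> * y x + g x)" for x
  have ac: "abs_cont (\<lambda>x. y x * cnj (y x)) e"
    unfolding e_def by (intro abs_cont_mult abs_cont_cnj y)
  have cont: "continuous_on {0..} y"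
    by (rule abs_cont_continuous_on[OF y])
  \<comment> \<open>This is the boundary term of the integrated inequality. For negative
    \<open>\<mu>\<close> the unknown \<open>cmod (y T)\<close> enters with a favourable sign; for
    positive \<open>\<mu>\<close>, where homogeneous solutions grow, it is controlled by the assumed
    bound.\<close>
  obtain K where K: "\<And>T. 0 \<le> T \<Longrightarrow> \<sigma> * ((cmod (y T))\<^sup>2 - (cmod (y 0))\<^sup>2) \<le> K"
  proof (cases "\<mu> < 0")
    case True
    then have "\<sigma> = - 1"
      by (simp add: \<sigma>_def)
    then show thesis
      by (intro that[of "(cmod (y 0))\<^sup>2"]) auto
  next
    case False
    with \<mu> growth obtain C where C: "\<And>x. 0 \<le> x \<Longrightarrow> cmod (y x) \<le> C" and "\<sigma> = 1"
      by (auto simp: \<sigma>_def)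
    have "(cmod (y T))\<^sup>2 - (cmod (y 0))\<^sup>2 \<le> C\<^sup>2" if "0 \<le> T" for T
      using power_mono[OF C[OF that] norm_ge_zero, of 2] zero_le_power2[of "cmod (y 0)"] by linarith
    with \<open>\<sigma> = 1\<close> show thesis
      by (intro that[of "C\<^sup>2"]) auto
  qed
  have pointwise: "\<kappa> * (cmod (y x))\<^sup>2 \<le> \<sigma> * Re (e x) + (cmod (g x))\<^sup>2 / \<kappa>" for x
  proof -
    have "(cmod (complex_of_real \<kappa> * y x + complex_of_real \<sigma> * g x))\<^sup>2
        = \<kappa>\<^sup>2 * (cmod (y x))\<^sup>2 + \<sigma>\<^sup>2 * (cmod (g x))\<^sup>2 + 2 * \<kappa> * \<sigma> * Re (g x * cnj (y x))"
      by (simp only: cmod_power2) (simp add: power2_eq_square algebra_simps)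
    moreover have "\<sigma>\<^sup>2 = 1"
      using \<sigma> by auto
    ultimately have "0 \<le> \<kappa>\<^sup>2 * (cmod (y x))\<^sup>2 + (cmod (g x))\<^sup>2 + 2 * \<kappa> * \<sigma> * Re (g x * cnj (y x))"
      by (metis mult_1 zero_le_power2)
    then have "0 \<le> (\<kappa>\<^sup>2 * (cmod (y x))\<^sup>2 + (cmod (g x))\<^sup>2 + 2 * \<kappa> * \<sigma> * Re (g x * cnj (y x))) / \<kappa>"
      using \<kappa> by simp
    also have "\<dots> = \<kappa> * (cmod (y x))\<^sup>2 + (cmod (g x))\<^sup>2 / \<kappa> + 2 * \<sigma> * Re (g x * cnj (y x))"
      using \<kappa> by (simp add: field_simps power2_eq_square)
    finally have "0 \<le> \<kappa> * (cmod (y x))\<^sup>2 + (cmod (g x))\<^sup>2 / \<kappa> + 2 * \<sigma> * Re (g x * cnj (y x))" .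
    moreover have "Re (e x) = 2 * \<mu> * (cmod (y x))\<^sup>2 + 2 * Re (g x * cnj (y x))"
      unfolding e_def by (simp only: cmod_power2) (simp add: power2_eq_square algebra_simps)
    then have "\<sigma> * Re (e x) = 2 * \<kappa> * (cmod (y x))\<^sup>2 + 2 * \<sigma> * Re (g x * cnj (y x))"
      using \<sigma> by (auto simp: \<mu>_eq)
    ultimately show ?thesis
      by linarith
  qed
  define I where "I = (LINT x:{0<..}|lborel. (cmod (g x))\<^sup>2)"
  show ?thesis
  proof (rule L2_if_integrals_bounded[OF cont])
    fix T :: real assume T: "0 \<le> T"
    have e: "set_integrable lborel {0<..T} e"
      by (rule abs_contD(1)[OF ac T])
    have iy: "set_integrable lborel {0<..T} (\<lambda>x. (cmod (y x))\<^sup>2)"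
    proof (rule set_integrable_subset)
      show "set_integrable lborel {0..T} (\<lambda>x. (cmod (y x))\<^sup>2)"
        by (rule borel_integrable_atLeastAtMost') (auto intro!: continuous_intros continuous_on_subset[OF cont])
    qed auto
    have ig: "set_integrable lborel {0<..T} (\<lambda>x. (cmod (g x))\<^sup>2)"
      by (rule set_integrable_subset[OF L2D(2)[OF g]]) auto
    have "\<kappa> * (LINT x:{0<..T}|lborel. (cmod (y x))\<^sup>2) = (LINT x:{0<..T}|lborel. \<kappa> * (cmod (y x))\<^sup>2)"
      by simp
    also have "\<dots> \<le> (LINT x:{0<..T}|lborel. \<sigma> * Re (e x) + (cmod (g x))\<^sup>2 / \<kappa>)"
      using iy ig set_integral_Re(1)[OF e] pointwise by (intro set_integral_mono) auto
    also have "\<dots> = \<sigma> * Re (LINT x:{0<..T}|lborel. e x) + (LINT x:{0<..T}|lborel. (cmod (g x))\<^sup>2) / \<kappa>"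
      using ig set_integral_Re[OF e] by simp
    also have "(LINT x:{0<..T}|lborel. e x) = y T * cnj (y T) - y 0 * cnj (y 0)"
      using abs_contD(2)[OF ac T] by simp
    also have "Re (y T * cnj (y T) - y 0 * cnj (y 0)) = (cmod (y T))\<^sup>2 - (cmod (y 0))\<^sup>2"
      by (simp add: complex_mult_cnj cmod_power2)
    also have "\<sigma> * ((cmod (y T))\<^sup>2 - (cmod (y 0))\<^sup>2) + (LINT x:{0<..T}|lborel. (cmod (g x))\<^sup>2) / \<kappa> \<le> K + I / \<kappa>"
    proof -
      have "(LINT x:{0<..T}|lborel. (cmod (g x))\<^sup>2) \<le> I"
        unfolding I_def set_lebesgue_integral_def
        using ig L2D(2)[OF g] by (intro integral_mono) (auto simp: set_integrable_def indicator_def)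
      with K[OF T] \<kappa> show ?thesis
        by (intro add_mono divide_right_mono) auto
    qed
    finally show "(LINT x:{0<..T}|lborel. (cmod (y x))\<^sup>2) \<le> (K + I / \<kappa>) / \<kappa>"
      using \<kappa> by (simp add: field_simps)
  qed
qed

lemma L2_exp:
  assumes "0 < \<kappa>"
  shows "(\<lambda>x. complex_of_real (exp (- \<kappa> * x))) \<in> L2"
proof (rule L2_first_order[of "- \<kappa>" _ "\<lambda>_. 0"])
  show "abs_cont (\<lambda>x. complex_of_real (exp (- \<kappa> * x)))
      (\<lambda>x. complex_of_real (- \<kappa>) * complex_of_real (exp (- \<kappa> * x)) + 0)"
    using abs_cont_exp[of "- \<kappa>"] by simp
  show "(\<lambda>_. 0) \<in> L2"
    by (simp add: L2_def set_borel_measurable_def set_integrable_def)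
qed (use assms in auto)

lemma set_integral_half_line_split:
  fixes f :: "real \<Rightarrow> complex"
  assumes f: "set_integrable lborel {0<..} f" and T: "0 \<le> T"
  shows "set_integrable lborel {T<..} f"
    and "(LINT x:{0<..}|lborel. f x) = (LINT x:{0<..T}|lborel. f x) + (LINT x:{T<..}|lborel. f x)"
proof -
  show tail: "set_integrable lborel {T<..} f"
    by (rule set_integrable_subset[OF f]) (use T in auto)
  have "set_integrable lborel {0<..T} f"
    by (rule set_integrable_subset[OF f]) auto
  then have "(LINT x:{0<..T} \<union> {T<..}|lborel. f x) = (LINT x:{0<..T}|lborel. f x) + (LINT x:{T<..}|lborel. f x)"
    by (intro set_integral_Un tail) auto
  moreover have "{0<..T} \<union> {T<..} = {0<..}"
    using T by auto
  ultimately show "(LINT x:{0<..}|lborel. f x) = (LINT x:{0<..T}|lborel. f x) + (LINT x:{T<..}|lborel. f x)"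
    by simp
qed

lemma exp_tail_integral:
  fixes \<kappa> T :: real
  assumes "0 < \<kappa>" "0 \<le> T"
  shows "set_integrable lborel {T<..} (\<lambda>x. exp (- \<kappa> * x))"
    and "(LINT x:{T<..}|lborel. exp (- \<kappa> * x)) = exp (- \<kappa> * T) / \<kappa>"
proof -
  define E where "E x = complex_of_real (exp (- \<kappa> * x))" for x
  have E: "abs_cont E (\<lambda>x. complex_of_real (- \<kappa>) * E x)"
    using abs_cont_exp[of "- \<kappa>"] by (simp add: E_def[abs_def])
  \<comment> \<open>Integrability of the exponential comes from square-integrability of the one with
    half the rate.\<close>
  have "(\<lambda>x. complex_of_real (exp (- (\<kappa> / 2) * x)) * cnj (complex_of_real (exp (- (\<kappa> / 2) * x)))) = E"
    by (auto simp: E_def of_real_mult[symmetric] exp_add[symmetric] simp del: of_real_mult)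
  then have iE: "set_integrable lborel {0<..} E"
    using L2_mult_integrable[OF L2_exp L2_exp, of "\<kappa> / 2" "\<kappa> / 2"] assms by simp
  have E0: "E 0 = 1"
    by (simp add: E_def)
  note split = set_integral_half_line_split[OF iE assms(2)]
  note split(2)
  moreover have "- \<kappa> * (LINT x:{0<..}|lborel. E x) = - 1"
    using abs_cont_integral_half_line[OF E set_integrable_mult_right[OF iE] iE] E0
    by (simp only: set_integral_mult_right of_real_minus)
  moreover have "- \<kappa> * (LINT x:{0<..T}|lborel. E x) = E T - 1"
    using abs_contD(2)[OF E assms(2)] E0
    by (simp only: set_integral_mult_right of_real_minus) (simp add: algebra_simps)
  ultimately have "- \<kappa> * (LINT x:{T<..}|lborel. E x) = - E T"
    by (simp add: algebra_simps) (metis add_right_cancel)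
  then have "complex_of_real (\<kappa> * (LINT x:{T<..}|lborel. exp (- \<kappa> * x))) = complex_of_real (exp (- \<kappa> * T))"
    unfolding E_def set_integral_complex_of_real by simp
  then have "\<kappa> * (LINT x:{T<..}|lborel. exp (- \<kappa> * x)) = exp (- \<kappa> * T)"
    by (simp only: of_real_eq_iff)
  then show "(LINT x:{T<..}|lborel. exp (- \<kappa> * x)) = exp (- \<kappa> * T) / \<kappa>"
    using assms by (simp add: field_simps)
  show "set_integrable lborel {T<..} (\<lambda>x. exp (- \<kappa> * x))"
    using set_integral_Re(1)[OF split(1)] by (simp add: E_def)
qed

lemma L2_cnj: "f \<in> L2 \<Longrightarrow> (\<lambda>x. cnj (f x)) \<in> L2"
  by (simp add: L2_def set_borel_measurable_cnj)

text \<open>Solutions of this equation generally grow like \<open>exp (\<kappa> * x)\<close>, and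
  the initial value \<open>- I\<close> is the one that removes the growth. What remains at
  \<open>T\<close> is minus the integral of \<open>exp (\<kappa> * (T - x)) * g x\<close> over
  \<open>{T<..}\<close>; it is bounded in \<open>T\<close>, which is what
  \<open>L2_first_order\<close> asks for at a positive rate.\<close>

lemma decaying_solution:
  assumes \<kappa>: "0 < \<kappa>" and g: "g \<in> L2"
  shows "\<exists>p\<in>L2. abs_cont p (\<lambda>x. complex_of_real \<kappa> * p x + g x)"
proof
  define h where "h x = complex_of_real (exp (- \<kappa> * x)) * g x" for x
  define I where "I = (LINT t:{0<..}|lborel. h t)"
  define p where "p x = complex_of_real (exp (\<kappa> * x)) * (- I + (LINT t:{0<..x}|lborel. h t))" for x
  show ac: "abs_cont p (\<lambda>x. complex_of_real \<kappa> * p x + g x)"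
    using first_order_solution[OF L2_loc_int[OF g], of \<kappa> "- I"] by (simp add: p_def[abs_def] h_def[abs_def])
  have h: "set_integrable lborel {0<..} h"
    using L2_mult_integrable[OF L2_exp[OF \<kappa>] L2_cnj[OF g]] by (simp add: h_def[abs_def])
  define G where "G = (LINT x:{0<..}|lborel. (cmod (g x))\<^sup>2)"
  have bound: "cmod (p T) \<le> 1 / (2 * \<kappa>) + G" if T: "0 \<le> T" for T
  proof -
    note split = set_integral_half_line_split[OF h T, folded I_def]
    have "p T = - (LINT x:{T<..}|lborel. complex_of_real (exp (\<kappa> * T)) * h x)"
      unfolding p_def split(2) by simp
    then have "cmod (p T) = cmod (LINT x:{T<..}|lborel. complex_of_real (exp (\<kappa> * T)) * h x)"
      by (simp only: norm_minus_cancel)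
    also have "\<dots> \<le> (LINT x:{T<..}|lborel. exp (2 * \<kappa> * T) * exp (- (2 * \<kappa>) * x) + (cmod (g x))\<^sup>2)"
      unfolding set_lebesgue_integral_def
    proof (rule Bochner_Integration.integral_norm_bound_integral)
      show "integrable lborel (\<lambda>x. indicat_real {T<..} x *\<^sub>R (complex_of_real (exp (\<kappa> * T)) * h x))"
        using set_integrable_mult_right[OF split(1)] by (simp add: set_integrable_def)
      have "set_integrable lborel {T<..} (\<lambda>x. exp (2 * \<kappa> * T) * exp (- (2 * \<kappa>) * x) + (cmod (g x))\<^sup>2)"
      proof (rule set_integral_add(1))
        show "set_integrable lborel {T<..} (\<lambda>x. (cmod (g x))\<^sup>2)"
          by (rule set_integrable_subset[OF L2D(2)[OF g]]) (use T in auto)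
        show "set_integrable lborel {T<..} (\<lambda>x. exp (2 * \<kappa> * T) * exp (- (2 * \<kappa>) * x))"
          using exp_tail_integral(1)[of "2 * \<kappa>" T] \<kappa> T by (intro set_integrable_mult_right) auto
      qed
      then show "integrable lborel (\<lambda>x. indicat_real {T<..} x *\<^sub>R (exp (2 * \<kappa> * T) * exp (- (2 * \<kappa>) * x) + (cmod (g x))\<^sup>2))"
        by (simp only: set_integrable_def)
      fix x
      \<comment> \<open>The weight \<open>exp (\<kappa> * (T - x))\<close>; its square has integral
        \<open>1 / (2 * \<kappa>)\<close> over \<open>{T<..}\<close>, independently of
        \<open>T\<close>.\<close>
      define s where "s = exp (\<kappa> * T) * exp (- \<kappa> * x)"
      have "cmod (complex_of_real (exp (\<kappa> * T)) * h x) = s * cmod (g x)"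
        by (simp add: h_def norm_mult s_def)
      also have "\<dots> \<le> s\<^sup>2 + (cmod (g x))\<^sup>2"
      proof -
        have "0 \<le> s * cmod (g x)"
          by (simp add: s_def)
        then show ?thesis
          using sum_squares_bound[of s "cmod (g x)"] by linarith
      qed
      also have "s\<^sup>2 = exp (2 * \<kappa> * T) * exp (- (2 * \<kappa>) * x)"
        by (simp add: s_def power_mult_distrib exp_double[symmetric] mult.assoc)
      finally show "cmod (indicat_real {T<..} x *\<^sub>R (complex_of_real (exp (\<kappa> * T)) * h x))
          \<le> indicat_real {T<..} x *\<^sub>R (exp (2 * \<kappa> * T) * exp (- (2 * \<kappa>) * x) + (cmod (g x))\<^sup>2)"
        by (simp add: indicator_def)
    qed
    also have "\<dots> = exp (2 * \<kappa> * T) * (exp (- (2 * \<kappa>) * T) / (2 * \<kappa>)) + (LINT x:{T<..}|lborel. (cmod (g x))\<^sup>2)"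
    proof -
      have "set_integrable lborel {T<..} (\<lambda>x. (cmod (g x))\<^sup>2)"
        by (rule set_integrable_subset[OF L2D(2)[OF g]]) (use T in auto)
      then show ?thesis
        using exp_tail_integral[of "2 * \<kappa>" T] \<kappa> T by simp
    qed
    also have "exp (2 * \<kappa> * T) * (exp (- (2 * \<kappa>) * T) / (2 * \<kappa>)) = 1 / (2 * \<kappa>)"
      by (simp add: exp_minus field_simps)
    also have "(LINT x:{T<..}|lborel. (cmod (g x))\<^sup>2) \<le> G"
      unfolding G_def set_lebesgue_integral_def
    proof (rule integral_mono)
      show "integrable lborel (\<lambda>x. indicat_real {T<..} x *\<^sub>R (cmod (g x))\<^sup>2)"
        unfolding set_integrable_def[symmetric]
        by (rule set_integrable_subset[OF L2D(2)[OF g]]) (use T in auto)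
      show "integrable lborel (\<lambda>x. indicat_real {0<..} x *\<^sub>R (cmod (g x))\<^sup>2)"
        using L2D(2)[OF g] by (simp add: set_integrable_def)
    qed (use T in \<open>auto simp: indicator_def\<close>)
    finally show ?thesis
      by simp
  qed
  show "p \<in> L2"
    by (rule L2_first_order[OF _ ac g]) (use \<kappa> bound in auto)
qed

text \<open>The order of quantifiers matters: \<open>p0\<close> depends on \<open>g\<close> alone,
  so the derivative at the vertex is an affine function of the value \<open>r\<close> with slope
  \<open>- \<kappa>\<close>. The transmission conditions thereby become linear equations for the
  vertex values.\<close>

lemma branch_solution:
  assumes \<kappa>: "0 < \<kappa>" and g: "g \<in> L2"
  shows "\<exists>p0. \<forall>r. \<exists>v d. v \<in> L2 \<and> d \<in> L2 \<and> abs_cont v d \<and>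
           abs_cont d (\<lambda>x. (complex_of_real \<kappa>)\<^sup>2 * v x + g x) \<and> v 0 = r \<and> d 0 = p0 - complex_of_real \<kappa> * r"
proof -
  obtain p where p: "p \<in> L2" and acp: "abs_cont p (\<lambda>x. complex_of_real \<kappa> * p x + g x)"
    using decaying_solution[OF assms] by blast
  show ?thesis
  proof (intro exI[of _ "p 0"] allI)
    fix r
    define h where "h x = complex_of_real (exp (- (- \<kappa>) * x)) * p x" for x
    define v where "v x = complex_of_real (exp (- \<kappa> * x)) * (r + (LINT t:{0<..x}|lborel. h t))" for x
    define d where "d x = complex_of_real (- \<kappa>) * v x + p x" for x
    have acv: "abs_cont v d"
      using first_order_solution[OF L2_loc_int[OF p], of "- \<kappa>" r]
      by (simp add: v_def[abs_def] h_def[abs_def] d_def[abs_def])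
    then have v: "v \<in> L2"
      unfolding d_def[abs_def] by (rule L2_first_order[rotated]) (use \<kappa> p in auto)
    then have "d \<in> L2"
      unfolding d_def[abs_def] by (intro L2_add L2_cmult p)
    moreover have "abs_cont d (\<lambda>x. (complex_of_real \<kappa>)\<^sup>2 * v x + g x)"
    proof -
      have "abs_cont d (\<lambda>x. complex_of_real (- \<kappa>) * d x + (complex_of_real \<kappa> * p x + g x))"
        using abs_cont_add[OF abs_cont_cmult[OF acv, of "complex_of_real (- \<kappa>)"] acp] by (simp add: d_def[abs_def])
      \<comment> \<open>The terms in \<open>p\<close> cancel once \<open>d\<close> is
        expanded.\<close>
      also have "(\<lambda>x. complex_of_real (- \<kappa>) * d x + (complex_of_real \<kappa> * p x + g x))
          = (\<lambda>x. (complex_of_real \<kappa>)\<^sup>2 * v x + g x)"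
        by (auto simp: d_def power2_eq_square algebra_simps)
      finally show ?thesis .
    qed
    moreover have v0: "v 0 = r"
      by (simp add: v_def set_lebesgue_integral_def)
    moreover have "d 0 = p 0 - complex_of_real \<kappa> * r"
      by (simp add: d_def v0)
    ultimately show "\<exists>v d. v \<in> L2 \<and> d \<in> L2 \<and> abs_cont v d \<and>
           abs_cont d (\<lambda>x. (complex_of_real \<kappa>)\<^sup>2 * v x + g x) \<and> v 0 = r \<and> d 0 = p 0 - complex_of_real \<kappa> * r"
      using v acv by blast
  qed
qed

subsection \<open>A point of the resolvent set\<close>

text \<open>Stated for arbitrary triples instead of elements of \<open>dom_A\<close>, because
  injectivity applies it to a difference: the representative chosen for the weak derivative of a
  difference need not be the difference of the chosen representatives.\<close>

lemma network_energy_estimate: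
  fixes c a :: "nat \<Rightarrow> real" and u d h :: net_fun
  assumes "\<And>k. k < n \<Longrightarrow> 0 < c k" "\<And>k. k < n \<Longrightarrow> 0 \<le> a k"
    and "\<And>k. k < n \<Longrightarrow> u k \<in> L2" "\<And>k. k < n \<Longrightarrow> d k \<in> L2" "\<And>k. k < n \<Longrightarrow> h k \<in> L2"
    and "\<And>k. k < n \<Longrightarrow> abs_cont (u k) (d k)" "\<And>k. k < n \<Longrightarrow> abs_cont (d k) (h k)"
    and cont: "\<And>i k. i < n \<Longrightarrow> k < n \<Longrightarrow> u i 0 = u k 0"
    and kirchhoff: "(\<Sum>k<n. complex_of_real (c k) * d k 0) = 0"
  shows "(\<Sum>k<n. LINT x:{0<..}|lborel. (cmod (u k x))\<^sup>2) \<le>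
    (\<Sum>k<n. LINT x:{0<..}|lborel. (cmod (complex_of_real (c k) * h k x - complex_of_real (1 + a k) * u k x))\<^sup>2)"
proof -
  \<comment> \<open>Continuity lets the common vertex value be taken out of the sum, and the
    Kirchhoff sum remains.\<close>
  have "(\<Sum>k<n. complex_of_real (c k) * d k 0 * cnj (u k 0)) = (\<Sum>k<n. complex_of_real (c k) * d k 0) * cnj (u 0 0)"
    unfolding sum_distrib_right
  proof (rule sum.cong)
    fix k assume "k \<in> {..<n}"
    then have "u k 0 = u 0 0"
      by (intro cont) auto
    then show "complex_of_real (c k) * d k 0 * cnj (u k 0) = complex_of_real (c k) * d k 0 * cnj (u 0 0)"
      by simp
  qed simp
  then have "(\<Sum>k<n. Re (complex_of_real (c k) * d k 0 * cnj (u k 0))) = 0"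
    using kirchhoff by (simp only: Re_sum[symmetric]) simp
  moreover have "(\<Sum>k<n. LINT x:{0<..}|lborel. (cmod (u k x))\<^sup>2) \<le>
    (\<Sum>k<n. (LINT x:{0<..}|lborel. (cmod (complex_of_real (c k) * h k x - complex_of_real (1 + a k) * u k x))\<^sup>2)
            - 2 * Re (complex_of_real (c k) * d k 0 * cnj (u k 0)))"
    by (rule sum_mono, rule branch_energy_estimate) (use assms in auto)
  ultimately show ?thesis
    by (simp only: sum_subtractf sum_distrib_left[symmetric])
qed

lemma dom_A_D:
  assumes "u \<in> dom_A n c" "k < n"
  shows "u k \<in> L2" "D_half (u k) \<in> L2" "weak_deriv (weak_deriv (u k)) \<in> L2"
    and "abs_cont (u k) (D_half (u k))" "abs_cont (D_half (u k)) (weak_deriv (weak_deriv (u k)))"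
proof -
  have H2: "u k \<in> H2" and C: "u k \<in> C_halfline 1"
    using assms by (auto simp: dom_A_def T1_def)
  then show "u k \<in> L2"
    by (simp add: H2_def)
  show "D_half (u k) \<in> L2" "weak_deriv (weak_deriv (u k)) \<in> L2"
    "abs_cont (D_half (u k)) (weak_deriv (weak_deriv (u k)))"
    using H2_regularity[OF H2 C] by auto
  show "abs_cont (u k) (D_half (u k))"
    by (rule abs_cont_D_half[OF C])
qed

lemma dom_A_vertex:
  assumes "u \<in> dom_A n c"
  shows "i < n \<Longrightarrow> k < n \<Longrightarrow> u i 0 = u k 0" "(\<Sum>k<n. complex_of_real (c k) * D_half (u k) 0) = 0"
  using assms unfolding dom_A_def T0_def T1_def by blast+

context
  fixes n :: nat and c a :: "nat \<Rightarrow> real"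
  assumes c_pos: "\<And>k. k < n \<Longrightarrow> 0 < c k" and a_nonneg: "\<And>k. k < n \<Longrightarrow> 0 \<le> a k"
begin

abbreviation (input) resolvent_op :: "net_fun \<Rightarrow> net_fun" where
  "resolvent_op u \<equiv> (\<lambda>k x. (- 1) * u k x - op_A c a u k x)"

lemma resolvent_op_eq:
  "resolvent_op u k x =
     complex_of_real (c k) * weak_deriv (weak_deriv (u k)) x - complex_of_real (1 + a k) * u k x"
  by (simp add: op_A_def algebra_simps)

lemma resolvent_op_surj:
  assumes "2 \<le> n" and f: "f \<in> H_space n"
  shows "\<exists>u\<in>dom_A n c. eq_H n (resolvent_op u) f"
proof -
  define \<kappa> where "\<kappa> k = sqrt ((1 + a k) / c k)" for k
  have \<kappa>: "0 < \<kappa> k" "c k * (\<kappa> k)\<^sup>2 = 1 + a k" if "k < n" for k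
    using c_pos[OF that] a_nonneg[OF that] by (auto simp: \<kappa>_def)
  \<comment> \<open>Division by \<open>c k\<close> brings the equation on the branch into the form
    \<open>u'' = \<kappa>^2 u + g\<close>.\<close>
  define g where "g k x = complex_of_real (1 / c k) * f k x" for k x
  have g: "g k \<in> L2" if "k < n" for k
    unfolding g_def using f that by (intro L2_cmult) (auto simp: H_space_def)
  have "\<forall>k\<in>{..<n}. \<exists>p0. \<forall>r. \<exists>v d. v \<in> L2 \<and> d \<in> L2 \<and> abs_cont v d \<and>
      abs_cont d (\<lambda>x. (complex_of_real (\<kappa> k))\<^sup>2 * v x + g k x) \<and> v 0 = r \<and> d 0 = p0 - complex_of_real (\<kappa> k) * r"
    using branch_solution \<kappa>(1) g by auto
  then obtain p0 where p0: "\<forall>k\<in>{..<n}. \<forall>r. \<exists>v d. v \<in> L2 \<and> d \<in> L2 \<and> abs_cont v d \<and>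
      abs_cont d (\<lambda>x. (complex_of_real (\<kappa> k))\<^sup>2 * v x + g k x) \<and> v 0 = r \<and> d 0 = p0 k - complex_of_real (\<kappa> k) * r"
    by (rule bchoice[THEN exE]) blast
  define s where "s = (\<Sum>k<n. complex_of_real (c k) * complex_of_real (\<kappa> k))"
  have "0 < (\<Sum>k<n. c k * \<kappa> k)"
    using c_pos \<kappa>(1) \<open>2 \<le> n\<close> by (intro sum_pos) (auto simp: lessThan_empty_iff)
  moreover have "s = complex_of_real (\<Sum>k<n. c k * \<kappa> k)"
    by (simp add: s_def)
  ultimately have "s \<noteq> 0"
    by (simp only: of_real_eq_0_iff)
  \<comment> \<open>One value \<open>r\<close> for all branches settles continuity. The Kirchhoff
    condition is then a single linear equation for \<open>r\<close> with coefficient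
    \<open>s\<close>, a sum of positive terms.\<close>
  define r where "r = (\<Sum>k<n. complex_of_real (c k) * p0 k) / s"
  have "\<forall>k\<in>{..<n}. \<exists>vd. fst vd \<in> L2 \<and> snd vd \<in> L2 \<and> abs_cont (fst vd) (snd vd) \<and>
      abs_cont (snd vd) (\<lambda>x. (complex_of_real (\<kappa> k))\<^sup>2 * fst vd x + g k x) \<and>
      fst vd 0 = r \<and> snd vd 0 = p0 k - complex_of_real (\<kappa> k) * r"
    using p0 by simp
  then obtain vd where vd: "\<forall>k\<in>{..<n}. fst (vd k) \<in> L2 \<and> snd (vd k) \<in> L2 \<and> abs_cont (fst (vd k)) (snd (vd k)) \<and>
      abs_cont (snd (vd k)) (\<lambda>x. (complex_of_real (\<kappa> k))\<^sup>2 * fst (vd k) x + g k x) \<and>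
      fst (vd k) 0 = r \<and> snd (vd k) 0 = p0 k - complex_of_real (\<kappa> k) * r"
    by (rule bchoice[THEN exE]) blast
  define u where "u k = fst (vd k)" for k
  define d where "d k = snd (vd k)" for k
  define h where "h k x = (complex_of_real (\<kappa> k))\<^sup>2 * u k x + g k x" for k x
  have u: "u k \<in> L2" "d k \<in> L2" "abs_cont (u k) (d k)" "abs_cont (d k) (h k)"
    "u k 0 = r" "d k 0 = p0 k - complex_of_real (\<kappa> k) * r" if "k < n" for k
    using vd that by (auto simp: u_def d_def h_def[abs_def])
  have h: "h k \<in> L2" if "k < n" for k
    unfolding h_def by (intro L2_add L2_cmult u g that)
  have C: "u k \<in> C_halfline 1" "D_half (u k) 0 = d k 0" if "k < n" for k
    using C_halfline_1I[OF u(3)[OF that] abs_cont_continuous_on[OF u(4)[OF that]]] by auto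
  have H2: "u k \<in> H2" and W: "AE x in lborel. 0 < x \<longrightarrow> weak_deriv (weak_deriv (u k)) x = h k x" if "k < n" for k
    using H2I[OF u(1,2)[OF that] h[OF that] u(3,4)[OF that]] by auto
  have "u \<in> dom_A n c"
    unfolding dom_A_def
  proof (intro CollectI conjI allI impI)
    show "T0 n u"
      using u abs_cont_continuous_on[OF u(3)] by (auto simp: T0_def)
    have "(\<Sum>k<n. complex_of_real (c k) * D_half (u k) 0) =
        (\<Sum>k<n. complex_of_real (c k) * p0 k - complex_of_real (c k) * complex_of_real (\<kappa> k) * r)"
      by (rule sum.cong) (auto simp: C u algebra_simps)
    also have "\<dots> = (\<Sum>k<n. complex_of_real (c k) * p0 k) - s * r"
      by (simp add: sum_subtractf sum_distrib_right s_def)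
    also have "\<dots> = 0"
      using \<open>s \<noteq> 0\<close> by (simp add: r_def)
    finally show "T1 n c u"
      using C by (simp add: T1_def)
  qed (rule H2)
  moreover have "eq_H n (resolvent_op u) f"
    unfolding eq_H_def
  proof (intro allI impI)
    fix k assume k: "k < n"
    have c\<kappa>: "complex_of_real (c k) * (complex_of_real (\<kappa> k))\<^sup>2 = complex_of_real (1 + a k)"
      using \<kappa>(2)[OF k] by (metis of_real_mult of_real_power)
    have eq: "complex_of_real (c k) * h k x - complex_of_real (1 + a k) * u k x = f k x" for x
      using c_pos[OF k] unfolding c\<kappa>[symmetric] by (simp add: h_def g_def algebra_simps)
    show "AE x in lborel. 0 < x \<longrightarrow> resolvent_op u k x = f k x"
      using W[OF k] unfolding resolvent_op_eq by eventually_elim (auto simp only: eq)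
  qed
  ultimately show ?thesis
    by blast
qed

lemma resolvent_op_bounded:
  assumes u: "u \<in> dom_A n c"
  shows "norm_H n u \<le> norm_H n (resolvent_op u)"
  unfolding norm_H_def resolvent_op_eq
  by (intro real_sqrt_le_mono network_energy_estimate[where d = "\<lambda>k. D_half (u k)"])
     (fact c_pos a_nonneg dom_A_D[OF u] dom_A_vertex[OF u])+

lemma resolvent_op_inj:
  assumes u: "u \<in> dom_A n c" and v: "v \<in> dom_A n c" and eq: "eq_H n (resolvent_op u) (resolvent_op v)"
  shows "eq_H n u v"
  unfolding eq_H_def
proof (intro allI impI)
  fix k assume k: "k < n"
  define w where "w k x = u k x - v k x" for k x
  define d where "d k x = D_half (u k) x - D_half (v k) x" for k x
  define h where "h k x = weak_deriv (weak_deriv (u k)) x - weak_deriv (weak_deriv (v k)) x" for k x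
  define f where "f k x = complex_of_real (c k) * h k x - complex_of_real (1 + a k) * w k x" for k x
  have w: "w k \<in> L2" "d k \<in> L2" "h k \<in> L2" "abs_cont (w k) (d k)" "abs_cont (d k) (h k)" if "k < n" for k
    unfolding w_def d_def h_def
    by (intro L2_diff abs_cont_diff dom_A_D[OF u that] dom_A_D[OF v that])+
  have "(\<Sum>k<n. LINT x:{0<..}|lborel. (cmod (w k x))\<^sup>2) \<le> (\<Sum>k<n. LINT x:{0<..}|lborel. (cmod (f k x))\<^sup>2)"
    unfolding f_def
  proof (rule network_energy_estimate[where d = d])
    show "w i 0 = w j 0" if "i < n" "j < n" for i j
      using dom_A_vertex(1)[OF u that] dom_A_vertex(1)[OF v that] by (simp add: w_def)
    show "(\<Sum>k<n. complex_of_real (c k) * d k 0) = 0"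
      using dom_A_vertex(2)[OF u] dom_A_vertex(2)[OF v] by (simp add: d_def right_diff_distrib sum_subtractf)
  qed (use c_pos a_nonneg w in auto)
  also have "\<dots> = 0"
  proof (intro sum.neutral ballI)
    fix k assume "k \<in> {..<n}"
    then have k: "k < n" by simp
    have f: "f k \<in> L2"
      unfolding f_def by (intro L2_diff L2_cmult w k)
    have "AE x in lborel. 0 < x \<longrightarrow> resolvent_op u k x = resolvent_op v k x"
      using eq k by (simp add: eq_H_def)
    then have "AE x in lborel. indicat_real {0<..} x *\<^sub>R (cmod (f k x))\<^sup>2 = 0"
      unfolding resolvent_op_eq
      by eventually_elim (auto simp: indicator_def f_def h_def w_def algebra_simps)
    then show "(LINT x:{0<..}|lborel. (cmod (f k x))\<^sup>2) = 0"
      unfolding set_lebesgue_integral_def by (rule integral_eq_zero_AE)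
  qed
  finally have le: "(\<Sum>k<n. LINT x:{0<..}|lborel. (cmod (w k x))\<^sup>2) \<le> 0" .
  have nonneg: "0 \<le> (LINT x:{0<..}|lborel. (cmod (w k x))\<^sup>2)" for k
    unfolding set_lebesgue_integral_def by (intro integral_nonneg_AE AE_I2) auto
  have "(LINT x:{0<..}|lborel. (cmod (w k x))\<^sup>2) \<le> (\<Sum>k<n. LINT x:{0<..}|lborel. (cmod (w k x))\<^sup>2)"
    by (rule member_le_sum[where f = "\<lambda>k. LINT x:{0<..}|lborel. (cmod (w k x))\<^sup>2"]) (use k nonneg in auto)
  with le nonneg[of k] have "(LINT x:{0<..}|lborel. (cmod (w k x))\<^sup>2) = 0"
    by linarith
  then have "(LINT x|lborel. indicat_real {0<..} x *\<^sub>R (cmod (w k x))\<^sup>2) = 0"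
    by (simp only: set_lebesgue_integral_def)
  then have "AE x in lborel. indicat_real {0<..} x *\<^sub>R (cmod (w k x))\<^sup>2 = 0"
    using L2D(2)[OF w(1)[OF k]] unfolding set_integrable_def
    by (subst (asm) integral_nonneg_eq_0_iff_AE) auto
  then show "AE x in lborel. 0 < x \<longrightarrow> u k x = v k x"
    by eventually_elim (auto simp: indicator_def w_def)
qed

lemma minus_1_in_rho_A:
  assumes "2 \<le> n"
  shows "- 1 \<in> rho_A n c a"
  unfolding rho_A_def resolvent_set_def Let_def
\<comment> \<open>Since \<open>1 + a k \<ge> 1\<close> on every branch, the energy estimate holds
  with constant 1.\<close>
proof (intro CollectI conjI exI[of _ 1] ballI impI)
  fix u assume "u \<in> dom_A n c"
  then show "norm_H n u \<le> 1 * norm_H n (resolvent_op u)"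
    using resolvent_op_bounded by simp
qed (use resolvent_op_surj[OF assms] resolvent_op_inj in auto)

end

subsection \<open>Generalized eigenfunctions and the kernel\<close>

text \<open>The product of \<open>f\<close> with the integrating factor
  \<open>exp (- \<mu> * x)\<close> has derivative 0.\<close>

lemma first_order_ode_unique:
  fixes f :: "real \<Rightarrow> complex" and \<mu> :: real
  assumes "\<And>x. 0 \<le> x \<Longrightarrow> (f has_vector_derivative complex_of_real \<mu> * f x) (at x within {0..})" "0 \<le> x"
  shows "f x = f 0 * complex_of_real (exp (\<mu> * x))"
proof -
  define E where "E t = complex_of_real (exp (- \<mu> * t))" for t
  have E: "(E has_vector_derivative complex_of_real (- \<mu>) * E t) (at t within {0..})" if "0 \<le> t" for t
    unfolding E_def[abs_def]
    by (rule abs_cont_has_derivative[OF abs_cont_exp _ that]) (intro continuous_intros)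
  have "((\<lambda>t. f t * E t) has_vector_derivative 0) (at t within {0..})" if "0 \<le> t" for t
    using has_vector_derivative_mult[OF assms(1)[OF that] E[OF that]] by (simp add: algebra_simps)
  then obtain r where r: "\<And>t. t \<in> {0..} \<Longrightarrow> f t * E t = r"
    using has_vector_derivative_zero_constant[of "{0..}" "\<lambda>t. f t * E t"] by auto
  have "f x * E x = f 0"
    using r[of x] r[of 0] assms(2) by (simp add: E_def)
  then have "f 0 * complex_of_real (exp (\<mu> * x)) = f x * (E x * complex_of_real (exp (\<mu> * x)))"
    by (simp only: mult.assoc[symmetric])
  also have "E x * complex_of_real (exp (\<mu> * x)) = 1"
    by (simp add: E_def of_real_mult[symmetric] exp_add[symmetric] del: of_real_mult)
  finally show ?thesis by simp
qed

text \<open>\<open>D_half u + \<kappa> u\<close> and \<open>D_half u - \<kappa> u\<close> satisfy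
  first-order equations with rates \<open>\<kappa>\<close> and \<open>- \<kappa>\<close>, and
  \<open>u\<close> is recovered from their difference.\<close>

lemma second_order_ode:
  fixes \<kappa> :: real
  assumes u: "u \<in> C_halfline 2" and \<kappa>: "\<kappa> \<noteq> 0"
    and ode: "\<And>x. 0 \<le> x \<Longrightarrow> D_half (D_half u) x = (complex_of_real \<kappa>)\<^sup>2 * u x"
  shows "\<exists>A B. \<forall>x\<ge>0. u x = A * complex_of_real (exp (\<kappa> * x)) + B * complex_of_real (exp (- \<kappa> * x))"
proof -
  have d1: "(u has_vector_derivative D_half u x) (at x within {0..})"
    and d2: "(D_half u has_vector_derivative (complex_of_real \<kappa>)\<^sup>2 * u x) (at x within {0..})" if "0 \<le> x" for x
    using u that has_vector_derivative_D_half[of u x] has_vector_derivative_D_half[of "D_half u" x] ode[OF that]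
    by (auto simp: numeral_2_eq_2)
  have sol: "D_half u x + complex_of_real \<mu> * u x
      = (D_half u 0 + complex_of_real \<mu> * u 0) * complex_of_real (exp (\<mu> * x))" if "0 \<le> x" "\<mu>\<^sup>2 = \<kappa>\<^sup>2" for x \<mu>
  proof (rule first_order_ode_unique[of "\<lambda>x. D_half u x + complex_of_real \<mu> * u x"])
    fix t :: real assume t: "0 \<le> t"
    have "(complex_of_real \<kappa>)\<^sup>2 = complex_of_real \<mu> * complex_of_real \<mu>"
      using that(2) by (metis of_real_mult of_real_power power2_eq_square)
    then show "((\<lambda>x. D_half u x + complex_of_real \<mu> * u x) has_vector_derivative
        complex_of_real \<mu> * (D_half u t + complex_of_real \<mu> * u t)) (at t within {0..})"
      using has_vector_derivative_add[OF d2[OF t] has_vector_derivative_mult_right[OF d1[OF t], of "complex_of_real \<mu>"]]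
      by (simp add: algebra_simps)
  qed (use that in auto)
  define P where "P = D_half u 0 + complex_of_real \<kappa> * u 0"
  define M where "M = D_half u 0 - complex_of_real \<kappa> * u 0"
  have "u x = P / (2 * complex_of_real \<kappa>) * complex_of_real (exp (\<kappa> * x))
      + (- M / (2 * complex_of_real \<kappa>)) * complex_of_real (exp (- \<kappa> * x))" if "0 \<le> x" for x
  proof -
    have p: "D_half u x + complex_of_real \<kappa> * u x = P * complex_of_real (exp (\<kappa> * x))"
      using sol[OF that, of \<kappa>] by (simp add: P_def)
    have m: "D_half u x - complex_of_real \<kappa> * u x = M * complex_of_real (exp (- \<kappa> * x))"
      using sol[OF that, of "- \<kappa>"] by (simp add: M_def)
    have "2 * complex_of_real \<kappa> * u x = P * complex_of_real (exp (\<kappa> * x)) - M * complex_of_real (exp (- \<kappa> * x))"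
      unfolding p[symmetric] m[symmetric] by (simp add: algebra_simps)
    then show ?thesis
      using \<kappa> by (simp add: field_simps)
  qed
  then show ?thesis
    by blast
qed

text \<open>Equality is available only beyond the source coordinate 1. After multiplication by
  \<open>exp (\<kappa> * x)\<close>, two points of this range already separate the growing from the
  decaying part.\<close>

lemma exp_combination_unique:
  fixes \<kappa> :: real
  assumes \<kappa>: "0 < \<kappa>"
    and eq: "\<And>x. 1 < x \<Longrightarrow> A * complex_of_real (exp (\<kappa> * x)) + B * complex_of_real (exp (- \<kappa> * x))
        = C * complex_of_real (exp (- \<kappa> * x))"
  shows "A = 0" "B = C"
proof -
  have *: "A * complex_of_real (exp (2 * \<kappa> * x)) = C - B" if "1 < x" for x
  proof -
    have "(A * complex_of_real (exp (\<kappa> * x)) + B * complex_of_real (exp (- \<kappa> * x))) * complex_of_real (exp (\<kappa> * x))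
        = (C * complex_of_real (exp (- \<kappa> * x))) * complex_of_real (exp (\<kappa> * x))"
      using eq[OF that] by simp
    moreover have "complex_of_real (exp (- \<kappa> * x)) * complex_of_real (exp (\<kappa> * x)) = 1"
      by (simp add: of_real_mult[symmetric] exp_add[symmetric] del: of_real_mult)
    moreover have "complex_of_real (exp (\<kappa> * x)) * complex_of_real (exp (\<kappa> * x)) = complex_of_real (exp (2 * \<kappa> * x))"
      by (simp add: of_real_mult[symmetric] exp_add[symmetric] del: of_real_mult)
    ultimately show ?thesis
      by (simp only: distrib_right mult.assoc) (simp add: algebra_simps)
  qed
  have "A * (complex_of_real (exp (2 * \<kappa> * 3)) - complex_of_real (exp (2 * \<kappa> * 2))) = 0"
    using *[of 2] *[of 3] by (simp add: right_diff_distrib)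
  moreover have "complex_of_real (exp (2 * \<kappa> * 3)) \<noteq> complex_of_real (exp (2 * \<kappa> * 2))"
    using \<kappa> by (simp only: of_real_eq_iff exp_inj_iff)
  ultimately show "A = 0"
    by simp
  then show "B = C"
    using *[of 2] by simp
qed

theorem theorem8p1:
  fixes n :: nat and c a :: "nat \<Rightarrow> real"
  assumes "n \<ge> 2"
    and "\<And>k. k < n \<Longrightarrow> c k > 0"
    and "\<And>k. k < n \<Longrightarrow> 0 \<le> a k"
    and "mono_on {..<n} a"
  shows "\<not> (\<exists>(p::nat) (\<alpha> :: nat \<Rightarrow> nat \<Rightarrow> complex) (\<beta> :: nat \<Rightarrow> nat \<Rightarrow> complex)
              (w :: nat \<Rightarrow> real \<Rightarrow> complex \<Rightarrow> nat \<Rightarrow> complex).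
            (\<forall>q<p. \<forall>z\<in>rho_A n c a. (\<lambda>k x. w q x z k) \<in> ker_A_T n c a z) \<and>
            (\<forall>z\<in>rho_A n c a. \<forall>x>0. \<forall>y>0. \<forall>i<n. \<forall>j<n.
               res_kernel n c a i j x y z =
                 (if y \<le> x
                  then \<Sum>q<p. (\<Sum>l<p. \<alpha> l q * w l x z i) * w q y z j
                  else \<Sum>q<p. (\<Sum>l<p. \<beta> l q * w l x z i) * w q y z j)))"
proof
  assume "\<exists>(p::nat) (\<alpha> :: nat \<Rightarrow> nat \<Rightarrow> complex) (\<beta> :: nat \<Rightarrow> nat \<Rightarrow> complex)
              (w :: nat \<Rightarrow> real \<Rightarrow> complex \<Rightarrow> nat \<Rightarrow> complex).
            (\<forall>q<p. \<forall>z\<in>rho_A n c a. (\<lambda>k x. w q x z k) \<in> ker_A_T n c a z) \<and>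
            (\<forall>z\<in>rho_A n c a. \<forall>x>0. \<forall>y>0. \<forall>i<n. \<forall>j<n.
               res_kernel n c a i j x y z =
                 (if y \<le> x
                  then \<Sum>q<p. (\<Sum>l<p. \<alpha> l q * w l x z i) * w q y z j
                  else \<Sum>q<p. (\<Sum>l<p. \<beta> l q * w l x z i) * w q y z j))"
  then obtain p :: nat and \<alpha> \<beta> :: "nat \<Rightarrow> nat \<Rightarrow> complex" and w :: "nat \<Rightarrow> real \<Rightarrow> complex \<Rightarrow> nat \<Rightarrow> complex"
    where ker: "\<forall>q<p. \<forall>z\<in>rho_A n c a. (\<lambda>k x. w q x z k) \<in> ker_A_T n c a z"
      and rep: "\<forall>z\<in>rho_A n c a. \<forall>x>0. \<forall>y>0. \<forall>i<n. \<forall>j<n.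
               res_kernel n c a i j x y z =
                 (if y \<le> x
                  then \<Sum>q<p. (\<Sum>l<p. \<alpha> l q * w l x z i) * w q y z j
                  else \<Sum>q<p. (\<Sum>l<p. \<beta> l q * w l x z i) * w q y z j)"
    by blast
  have rho: "- 1 \<in> rho_A n c a"
    by (rule minus_1_in_rho_A) (use assms in auto)
  have n: "0 < n" "1 < n" "(0 + 1) mod n = 1"
    using assms(1) by auto
  define \<kappa> where "\<kappa> k = sqrt ((1 + a k) / c k)" for k
  have \<kappa>: "0 < \<kappa> k" "c k * (\<kappa> k)\<^sup>2 = 1 + a k" if "k < n" for k
    using assms(2,3)[OF that] by (auto simp: \<kappa>_def)
  \<comment> \<open>On the negative axis the root takes the argument \<open>- pi\<close>, whence the
    factor \<open>- \<i>\<close>. Together with the value \<open>- 1\<close> of \<open>sg\<close> at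
    real parameters it makes the exponentials in \<open>F_gen\<close> decay.\<close>
  have xi: "xi c a (- 1) k = - \<i> * complex_of_real (\<kappa> k)" if "k < n" for k
  proof -
    define r where "r = (1 + a k) / c k"
    have "0 < r"
      using assms(2,3)[OF that] by (simp add: r_def)
    have "(- 1 - complex_of_real (a k)) / complex_of_real (c k) = complex_of_real (- r)"
      by (simp add: r_def divide_simps)
    then have "xi c a (- 1) k = branch_sqrt (complex_of_real (- r))"
      unfolding xi_def by (simp only:)
    moreover have "Arg (complex_of_real (- r)) = pi"
      using \<open>0 < r\<close> by (intro Arg_of_real[THEN trans]) auto
    moreover have "cmod (complex_of_real (- r)) = r"
      using \<open>0 < r\<close> by simp
    moreover have "cis (- pi / 2) = - \<i>"
      by (simp add: complex_eq_iff)
    moreover have "\<kappa> k = sqrt r"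
      by (simp add: \<kappa>_def r_def)
    ultimately show ?thesis
      by (simp only: branch_sqrt_def if_True refl mult.commute)
  qed
  \<comment> \<open>With \<open>x = 1\<close> on branch 0 fixed, the inner sums are constants. The
    function \<open>S j\<close> built from them makes sense for all \<open>y \<ge> 0\<close>, but is
    compared with the kernel only for \<open>1 < y\<close>, where the coefficients
    \<open>\<beta>\<close> apply.\<close>
  define \<gamma> where "\<gamma> q = (\<Sum>l<p. \<beta> l q * w l 1 (- 1) 0)" for q
  define S where "S j y = (\<Sum>q<p. \<gamma> q * w q y (- 1) j)" for j y
  have kernel: "res_kernel n c a 0 j 1 y (- 1) = S j y" if "1 < y" "j < n" for j y
    using rep[rule_format, OF rho, of 1 y 0 j] that n by (simp add: S_def \<gamma>_def)
  have w: "(\<lambda>k x. w q x (- 1) k) \<in> ker_A_T n c a (- 1)" if "q < p" for q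
    using ker[rule_format, OF that rho] .
  have S0: "S 0 0 = S 1 0"
    unfolding S_def
  proof (rule sum.cong)
    fix q assume "q \<in> {..<p}"
    then have "T0 n (\<lambda>k x. w q x (- 1) k)"
      using w[of q] by (simp add: ker_A_T_def dom_A_T_def)
    then have "w q 0 (- 1) 0 = w q 0 (- 1) 1"
      using n(1,2) unfolding T0_def by blast
    then show "\<gamma> q * w q 0 (- 1) 0 = \<gamma> q * w q 0 (- 1) 1"
      by simp
  qed simp
  have S_exp: "\<exists>A B. \<forall>y\<ge>0. S j y = A * complex_of_real (exp (\<kappa> j * y)) + B * complex_of_real (exp (- \<kappa> j * y))"
    if j: "j < n" for j
  proof -
    have "\<exists>AB. \<forall>y\<ge>0. w q y (- 1) j = fst AB * complex_of_real (exp (\<kappa> j * y)) + snd AB * complex_of_real (exp (- \<kappa> j * y))"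
      if "q < p" for q
    proof -
      let ?u = "\<lambda>x. w q x (- 1) j"
      have "?u \<in> C_halfline 2" and ode: "\<And>x. 0 \<le> x \<Longrightarrow> op_A_T c a (\<lambda>k x. w q x (- 1) k) j x - (- 1) * ?u x = 0"
        using w[OF that] j by (auto simp: ker_A_T_def dom_A_T_def)
      moreover have "D_half (D_half ?u) x = (complex_of_real (\<kappa> j))\<^sup>2 * ?u x" if "0 \<le> x" for x
      proof -
        have "complex_of_real (c j) * D_half (D_half ?u) x = complex_of_real (1 + a j) * ?u x"
          using ode[OF that] by (simp add: op_A_T_def algebra_simps)
        also have "complex_of_real (1 + a j) = complex_of_real (c j) * (complex_of_real (\<kappa> j))\<^sup>2"
          using \<kappa>(2)[OF j] by (metis of_real_mult of_real_power)
        finally show ?thesis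
          using assms(2)[OF j] by (simp add: mult.assoc)
      qed
      ultimately obtain A B where "\<forall>y\<ge>0. ?u y = A * complex_of_real (exp (\<kappa> j * y)) + B * complex_of_real (exp (- \<kappa> j * y))"
        using second_order_ode[of ?u "\<kappa> j"] \<kappa>(1)[OF j] by auto
      then show ?thesis
        by (intro exI[of _ "(A, B)"]) simp
    qed
    then have "\<forall>q\<in>{..<p}. \<exists>AB. \<forall>y\<ge>0. w q y (- 1) j = fst AB * complex_of_real (exp (\<kappa> j * y)) + snd AB * complex_of_real (exp (- \<kappa> j * y))"
      by simp
    then obtain AB where AB: "\<forall>q\<in>{..<p}. \<forall>y\<ge>0. w q y (- 1) j
        = fst (AB q) * complex_of_real (exp (\<kappa> j * y)) + snd (AB q) * complex_of_real (exp (- \<kappa> j * y))"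
      by (rule bchoice[THEN exE]) blast
    have "S j y = (\<Sum>q<p. \<gamma> q * fst (AB q)) * complex_of_real (exp (\<kappa> j * y))
        + (\<Sum>q<p. \<gamma> q * snd (AB q)) * complex_of_real (exp (- \<kappa> j * y))" if "0 \<le> y" for y
    proof -
      have "S j y = (\<Sum>q<p. \<gamma> q * (fst (AB q) * complex_of_real (exp (\<kappa> j * y)) + snd (AB q) * complex_of_real (exp (- \<kappa> j * y))))"
        unfolding S_def using AB that by (intro sum.cong) auto
      then show ?thesis
        by (simp add: distrib_left sum.distrib sum_distrib_right mult.assoc)
    qed
    then show ?thesis
      by blast
  qed
  \<comment> \<open>Beyond 1 the growing exponential is excluded and the other coefficient is
    determined; as both are constants, this settles the value at the vertex.\<close>
  have S_at_0: "S j 0 = C"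
    if j: "j < n" and C: "\<And>y. 1 < y \<Longrightarrow> res_kernel n c a 0 j 1 y (- 1) = C * complex_of_real (exp (- \<kappa> j * y))" for j C
  proof -
    obtain A B where AB: "\<forall>y\<ge>0. S j y = A * complex_of_real (exp (\<kappa> j * y)) + B * complex_of_real (exp (- \<kappa> j * y))"
      using S_exp[OF j] by blast
    then have "A * complex_of_real (exp (\<kappa> j * y)) + B * complex_of_real (exp (- \<kappa> j * y)) = C * complex_of_real (exp (- \<kappa> j * y))"
      if "1 < y" for y
      using C[OF that] kernel[OF that j] that by simp
    from exp_combination_unique[OF \<kappa>(1)[OF j] this] AB show ?thesis
      by simp
  qed
  define W where "W = w_scalar n c a (- 1)"
  have sum_xi: "(\<Sum>l\<in>L. complex_of_real (c l) * xi c a (- 1) l) = - \<i> * complex_of_real (\<Sum>l\<in>L. c l * \<kappa> l)"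
    if "L \<subseteq> {..<n}" for L
    unfolding of_real_sum sum_distrib_left using that by (intro sum.cong) (auto simp: xi subset_eq)
  have "W = - complex_of_real (\<Sum>k<n. c k * \<kappa> k)"
    unfolding W_def w_scalar_def sum_xi[OF subset_refl] by (simp add: sg_def)
  moreover have "0 < (\<Sum>k<n. c k * \<kappa> k)"
    using assms(2) \<kappa>(1) n(1) by (intro sum_pos) (auto simp: lessThan_empty_iff)
  ultimately have "W \<noteq> 0"
    by (simp only: neg_equal_0_iff_equal of_real_eq_0_iff)
  have F: "F_gen n c a (- 1) i k x = complex_of_real (exp (- \<kappa> k * x))" if "k \<noteq> i" "k < n" for i k x
    using that by (simp add: F_gen_def sg_def xi exp_of_real[symmetric] mult.assoc[symmetric])
  \<comment> \<open>The factor evaluated at \<open>x = 1\<close> differs between the two entries: on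
    branch 0 it comes from the function with index 0 on its own branch, on branch 1 from the
    function with index 1, a pure exponential on branch 0. The indices 0 and
    \<open>(0 + 1) mod n\<close> are distinct because \<open>n \<ge> 2\<close>.\<close>
  have "S 0 0 = F_gen n c a (- 1) 0 0 1 / W"
    by (rule S_at_0) (use n F in \<open>auto simp: res_kernel_def W_def\<close>)
  moreover have "S 1 0 = complex_of_real (exp (- \<kappa> 0)) / W"
    by (rule S_at_0) (use n F in \<open>auto simp: res_kernel_def W_def\<close>)
  ultimately have F_eq: "F_gen n c a (- 1) 0 0 1 = complex_of_real (exp (- \<kappa> 0))"
    using S0 \<open>W \<noteq> 0\<close> by simp
  \<comment> \<open>The factors \<open>- \<i>\<close> in numerator and denominator of
    \<open>s_coef\<close> cancel and leave a ratio of positive quantities.\<close>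
  define \<sigma> where "\<sigma> = (\<Sum>l\<in>{..<n} - {0}. c l * \<kappa> l) / (c 0 * \<kappa> 0)"
  have "0 \<le> \<sigma>"
    unfolding \<sigma>_def using assms(2) \<kappa>(1) n(1) by (intro divide_nonneg_nonneg sum_nonneg mult_nonneg_nonneg) (auto simp: less_imp_le)
  have s: "s_coef n c a (- 1) 0 = - complex_of_real \<sigma>"
    unfolding s_coef_def sum_xi[OF Diff_subset] using n(1) by (simp add: xi \<sigma>_def)
  \<comment> \<open>At an imaginary argument cosine and sine become \<open>cosh\<close> and
    \<open>- \<i>\<close> times \<open>sinh\<close>; the factor \<open>\<i>\<close> in front of the
    sine makes its term real.\<close>
  have cos: "cos (- \<i> * complex_of_real (\<kappa> 0)) = complex_of_real ((exp (\<kappa> 0) + exp (- \<kappa> 0)) / 2)"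
    and sin: "sin (- \<i> * complex_of_real (\<kappa> 0)) = - \<i> * complex_of_real ((exp (\<kappa> 0) - exp (- \<kappa> 0)) / 2)"
    unfolding cos_exp_eq sin_exp_eq
    by (simp_all add: mult.assoc[symmetric] exp_of_real[symmetric] field_simps)
  have "F_gen n c a (- 1) 0 0 1 =
      complex_of_real ((exp (\<kappa> 0) + exp (- \<kappa> 0)) / 2 + \<sigma> * ((exp (\<kappa> 0) - exp (- \<kappa> 0)) / 2))"
  proof -
    have "F_gen n c a (- 1) 0 0 1 = cos (- \<i> * complex_of_real (\<kappa> 0))
        + \<i> * complex_of_real \<sigma> * sin (- \<i> * complex_of_real (\<kappa> 0))"
      unfolding F_gen_def s xi[OF n(1)] by (simp add: sg_def)
    also have "\<dots> = complex_of_real ((exp (\<kappa> 0) + exp (- \<kappa> 0)) / 2)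
        + complex_of_real \<sigma> * complex_of_real ((exp (\<kappa> 0) - exp (- \<kappa> 0)) / 2)"
      unfolding cos sin by (simp add: algebra_simps)
    finally show ?thesis
      by simp
  qed
  \<comment> \<open>The left side is at least \<open>cosh (\<kappa> 0)\<close>, which exceeds
    \<open>exp (- \<kappa> 0)\<close> by \<open>sinh (\<kappa> 0) > 0\<close>.\<close>
  then have "(exp (\<kappa> 0) + exp (- \<kappa> 0)) / 2 + \<sigma> * ((exp (\<kappa> 0) - exp (- \<kappa> 0)) / 2) = exp (- \<kappa> 0)"
    unfolding F_eq by (simp only: of_real_eq_iff)
  moreover have "exp (- \<kappa> 0) < exp (\<kappa> 0)"
    using \<kappa>(1)[OF n(1)] by simp
  moreover have "0 \<le> \<sigma> * ((exp (\<kappa> 0) - exp (- \<kappa> 0)) / 2)"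
    using \<open>0 \<le> \<sigma>\<close> \<kappa>(1)[OF n(1)] by simp
  ultimately show False
    by argo
qed

end
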